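(* Let $(P_{s,s+t})_{s,t\ge0}$ be the transition function of a non-homogeneous càdlàg Markov process $(X_t)_{t\ge0}$ on a Lusin topological space $E$, and let $Q_tF(x,s):=P_{s,s+t}\big(F(\cdot,s+t)\big)(x)$, $x\in E$, $s,t\ge0$, be the transition function of the associated space-time process on $E\times[0,\infty)$. Suppose that there is a càdlàg right process $Z$ on $E\times[0,\infty)$ with transition function $(Q_t)_{t\ge0}$ (a version of the space-time process $((X_{u_t},u_t))_{t\ge 0}$, where $(u_t)_{t\ge 0}$ is the uniform motion to the right), and let $\overline{\mathcal U}=(\overline U_\alpha)_{\alpha>0}$ be its resolvent. With $(L_s)_{s\ge 0}$ and $D_\alpha(\Lambda)$ defined as in the context, let $G\subset E$ be open and assume that there exist $(f_n)_{n\ge1}\subset C_b^+(E)$, $(\varphi_n)_{n\ge1}\subset C(\mathbb R,\mathbb R_+)$ and $\alpha_0>0$ such that: (i) for every $x\in\overline G$ and $y\in G$ with $x\ne y$ there is $n$ with $f_n(x)<f_n(y)$; (ii) $0\le\varphi_k(r)\nearrow r^+$ as $k\to\infty$ for all $r\in\mathbb R$, and, regarding functions on $E$ as time-independent functions on $E\times[0,\infty)$, $\mathcal C:=\{\varphi_k(f_n-\varepsilon):n,k\ge1,\varepsilon\in\mathbb R_+\}\subset D_{\alpha_0}(\Lambda)$; (iii) for all $u\in\mathcal C$ and every $s\ge0$, $L_su=0$ on $\operatorname{int}([u=0])\cap G$ (up to a $\overline{\mathcal U}$-negligible set of points $(x,s)$). Then the homogeneous process $Z$ is a diffusion in $\widetilde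 G:=G\times[0,\infty)$.
   Context: **Generator.** For $\alpha>0$, $D_\alpha(\Lambda)$ is the set of bounded Borel functions $F$ on $E\times[0,\infty)$ (variables $(x,s)$, space and time) which are differentiable in time with $\left|\frac{dF}{dt}\right|_\infty<\infty$, such that the limit $L_sF(\cdot,s)(x):=\lim_{t\searrow0}\frac{P_{s,s+t}F(\cdot,s)(x)-F(x,s)}{t}$ exists for $\overline{\mathcal U}$-a.e. $(x,s)$, and such that there is a nonnegative measurable $V_F$ on $E\times[0,\infty)$ with $\overline U_\alpha V_F<\infty$ and $\left|\frac{Q_tF-F}{t}\right|\le V_F$ $\overline{\mathcal U}$-a.e. on $E\times[0,\infty)$ for all $t>0$. (The corresponding parabolic operator is $\Lambda F(x,t)=\frac{dF(x,\cdot)}{dt}(t)+L_tF(\cdot,t)(x)$.) A set $A$ is $\overline{\mathcal U}$-negligible if $\overline U_q1_A\equiv0$ for one (hence all) $q>0$, and $\overline{\mathcal U}$-a.e. means outside a $\overline{\mathcal U}$-negligible set. $C_b^+(E)$ is the set of bounded nonnegative continuous functions; $\operatorname{int}$ is the topological interior in $E$, $[u=0]=\{x:u(x)=0\}$. **Right processes.** A topological space is Lusin if homeomorphic to a Borel subset of a compact metrizable space. Let $Z$ be a Markov process on a Lusin space $S$ with Borel $\sigma$-algebra $\mathcal B(S)$, lifetime $\zeta$ and resolvent $\overline{\mathcal U}$. For $q\ge 0$, a Borel $v:S\to[0,\infty]$ is $q$-excessive if $\alpha \overline U_{q+\alpha}v\le v$ for all $\alpha>0$ and $\sup_\alpha\alpha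 \overline U_{q+\alpha}v=v$. $Z$ is a right process if it is normal, with right-continuous, universally augmented filtration and a.s. right continuous paths, and for $q>0$ and each $q$-excessive $f$ the process $f(Z)$ is a.s. right continuous under every $\mathbb P^z$. Càdlàg: a.s. right continuous with left limits in $S$ on $[0,\zeta)$. **Diffusion in an open set $\widetilde G\subset S$.** With $T_A:=\inf\{t>0:Z_t\in A\}$, choose open $G_n\subset\widetilde G$ with $\overline G_n\subset G_{n+1}$, $\bigcup_nG_n=\widetilde G$; $S_n^1:=T_{G_n}$, $T_n^k:=S_n^k+T_{S\setminus\widetilde G}\circ\theta_{S_n^k}$ ($k\ge1$), $S_n^k:=T_n^{k-1}+T_{G_n}\circ\theta_{T_n^{k-1}}$ ($k\ge2$); $I_{\widetilde G}:=\bigcup_n\bigcup_k(S_n^k,T_n^k)$ (independent of the choice of $(G_n)$). $Z$ is a diffusion in $\widetilde G$ if for every starting point $z\in S$, $\mathbb P^z$-a.s. the map $I_{\widetilde G}\cap[0,\zeta)\ni t\mapsto Z_t$ is continuous (no condition where this set is empty). *)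

theory Defs
  imports "HOL-Probability.Probability"
begin

section \<open>Lusin spaces and Borel structure\<close>

text \<open>A compact metrizable space has at most continuum many points, so letting the compact
  space \<open>K\<close> live on a subset of the type \<^typ>\<open>real\<close> (with an arbitrary compact metrizable
  topology) is no restriction.\<close>

definition lusin_space :: "'a topology \<Rightarrow> bool" where
  "lusin_space X \<longleftrightarrow>
     (\<exists>(K :: real topology) B. compact_space K \<and> metrizable_space K \<and>
        B \<in> sigma_sets (topspace K) {U. openin K U} \<and>
        X homeomorphic_space subtopology K B)"

abbreviation borel_on :: "'s::topological_space set \<Rightarrow> 's measure" where
  "borel_on S \<equiv> restrict_space borel S"


section \<open>Kernels, resolvents, excessive functions\<close>

text \<open>Kernels are sub-Markovian: mass may be lost to the cemetery.\<close>

definition transition_function :: "'s::topological_space set \<Rightarrow> (real \<Rightarrow> 's \<Rightarrow> 's measure) \<Rightarrow> bool" where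
  "transition_function S Q \<longleftrightarrow>
     (\<forall>t\<ge>0. Q t \<in> borel_on S \<rightarrow>\<^sub>M subprob_algebra (borel_on S)) \<and>
     (\<forall>z\<in>S. Q 0 z = return (borel_on S) z) \<and>
     (\<forall>s\<ge>0. \<forall>t\<ge>0. \<forall>z\<in>S. Q (s + t) z = Q s z \<bind> Q t)"

definition nonhom_transition_function :: "(real \<Rightarrow> real \<Rightarrow> 'e::topological_space \<Rightarrow> 'e measure) \<Rightarrow> bool" where
  "nonhom_transition_function P \<longleftrightarrow>
     (\<forall>s\<ge>0. \<forall>t\<ge>s. P s t \<in> borel \<rightarrow>\<^sub>M subprob_algebra borel) \<and>
     (\<forall>s\<ge>0. \<forall>x. P s s x = return borel x) \<and>
     (\<forall>s\<ge>0. \<forall>u\<ge>s. \<forall>t\<ge>u. \<forall>x. P s t x = P s u x \<bind> P u t)"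

definition resolvent ::
    "(real \<Rightarrow> 's \<Rightarrow> 's measure) \<Rightarrow> real \<Rightarrow> ('s \<Rightarrow> ennreal) \<Rightarrow> 's \<Rightarrow> ennreal" where
  "resolvent Q \<alpha> f z =
     (\<integral>\<^sup>+t\<in>{0..}. ennreal (exp (- \<alpha> * t)) * (\<integral>\<^sup>+y. f y \<partial>Q t z) \<partial>lborel)"

definition excessive ::
    "'s::topological_space set \<Rightarrow> (real \<Rightarrow> 's \<Rightarrow> 's measure) \<Rightarrow> real \<Rightarrow> ('s \<Rightarrow> ennreal) \<Rightarrow> bool" where
  "excessive S Q q v \<longleftrightarrow>
     v \<in> borel_measurable (borel_on S) \<and>
     (\<forall>\<alpha>>0. \<forall>z\<in>S. ennreal \<alpha> * resolvent Q (q + \<alpha>) v z \<le> v z) \<and>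
     (\<forall>z\<in>S. (SUP \<alpha>\<in>{0<..}. ennreal \<alpha> * resolvent Q (q + \<alpha>) v z) = v z)"

definition negligible_for ::
    "'s::topological_space set \<Rightarrow> (real \<Rightarrow> 's \<Rightarrow> 's measure) \<Rightarrow> 's set \<Rightarrow> bool" where
  "negligible_for S Q N \<longleftrightarrow>
     N \<in> sets (borel_on S) \<and> (\<exists>q>0. \<forall>z\<in>S. resolvent Q q (indicator N) z = 0)"

definition ae_for ::
    "'s::topological_space set \<Rightarrow> (real \<Rightarrow> 's \<Rightarrow> 's measure) \<Rightarrow> ('s \<Rightarrow> bool) \<Rightarrow> bool" where
  "ae_for S Q R \<longleftrightarrow> (\<exists>N. negligible_for S Q N \<and> (\<forall>z\<in>S - N. R z))"


section \<open>Paths with a cemetery\<close>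

text \<open>A path takes values in the state space with an isolated cemetery \<^const>\<open>None\<close> adjoined.\<close>

definition absorbed_from :: "real \<Rightarrow> (real \<Rightarrow> 's option) \<Rightarrow> bool" where
  "absorbed_from r p \<longleftrightarrow> (\<forall>t\<ge>r. \<forall>u\<ge>t. p t = None \<longrightarrow> p u = None)"

definition path_tendsto :: "(real \<Rightarrow> 's::topological_space option) \<Rightarrow> 's \<Rightarrow> real filter \<Rightarrow> bool" where
  "path_tendsto p z Fl \<longleftrightarrow> (\<forall>U. open U \<longrightarrow> z \<in> U \<longrightarrow> (\<forall>\<^sub>F u in Fl. \<exists>y\<in>U. p u = Some y))"

definition right_continuous_from :: "real \<Rightarrow> (real \<Rightarrow> 's::topological_space option) \<Rightarrow> bool" where
  "right_continuous_from r p \<longleftrightarrow> (\<forall>t\<ge>r. \<forall>z. p t = Some z \<longrightarrow> path_tendsto p z (at_right t))"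

definition left_limits_from ::
    "'s::topological_space set \<Rightarrow> real \<Rightarrow> (real \<Rightarrow> 's option) \<Rightarrow> bool" where
  "left_limits_from S r p \<longleftrightarrow>
     (\<forall>t>r. p t \<noteq> None \<longrightarrow> (\<exists>z\<in>S. path_tendsto p z (at_left t)))"

definition lifetime :: "(real \<Rightarrow> 'w \<Rightarrow> 's option) \<Rightarrow> 'w \<Rightarrow> ereal" where
  "lifetime Z \<omega> = Inf {ereal t | t. 0 \<le> t \<and> Z t \<omega> = None}"

text \<open>Functions on the state space vanish at the cemetery.\<close>

abbreviation at_state :: "('s \<Rightarrow> ennreal) \<Rightarrow> 's option \<Rightarrow> ennreal" where
  "at_state f y \<equiv> case_option 0 f y"


section \<open>Markov processes and right processes\<close>

text \<open>\<open>M\<close> carries the ambient \<open>\<sigma>\<close>-algebra on the sample space, \<open>Ft\<close> the filtration,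
  \<open>\<theta>\<close> the shift operators and \<open>Pr z\<close> the law with starting point \<open>z\<close>.
  As usual, the kernel property of \<open>Pr\<close> is with respect to universally measurable sets.\<close>

locale markov_process =
  fixes S :: "'s::topological_space set"
    and Q :: "real \<Rightarrow> 's \<Rightarrow> 's measure"
    and M :: "'w measure"
    and Ft :: "real \<Rightarrow> 'w measure"
    and Z :: "real \<Rightarrow> 'w \<Rightarrow> 's option"
    and \<theta> :: "real \<Rightarrow> 'w \<Rightarrow> 'w"
    and Pr :: "'s \<Rightarrow> 'w measure"
  assumes transition_function: "transition_function S Q"
    and subalgebra_Ft: "\<And>t. 0 \<le> t \<Longrightarrow> subalgebra M (Ft t)"
    and mono_Ft: "\<And>t u. 0 \<le> t \<Longrightarrow> t \<le> u \<Longrightarrow> sets (Ft t) \<subseteq> sets (Ft u)"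
    and sets_Pr: "\<And>z. z \<in> S \<Longrightarrow> sets (Pr z) = sets M"
    and prob_space_Pr: "\<And>z. z \<in> S \<Longrightarrow> prob_space (Pr z)"
    and universally_measurable_Pr:
      "\<And>A \<mu>. A \<in> sets M \<Longrightarrow> prob_space \<mu> \<Longrightarrow> sets \<mu> = sets (borel_on S) \<Longrightarrow>
        (\<lambda>z. emeasure (Pr z) A) \<in> borel_measurable (completion \<mu>)"
    and state_space: "\<And>t \<omega> z. 0 \<le> t \<Longrightarrow> \<omega> \<in> space M \<Longrightarrow> Z t \<omega> = Some z \<Longrightarrow> z \<in> S"
    and absorbed: "\<And>\<omega>. \<omega> \<in> space M \<Longrightarrow> absorbed_from 0 (\<lambda>t. Z t \<omega>)"
    and adapted:
      "\<And>t B. 0 \<le> t \<Longrightarrow> B \<in> sets (borel_on S) \<Longrightarrow>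
        {\<omega> \<in> space M. \<exists>y\<in>B. Z t \<omega> = Some y} \<in> sets (Ft t)"
    and shift_space: "\<And>t \<omega>. 0 \<le> t \<Longrightarrow> \<omega> \<in> space M \<Longrightarrow> \<theta> t \<omega> \<in> space M"
    and shift: "\<And>s t \<omega>. 0 \<le> s \<Longrightarrow> 0 \<le> t \<Longrightarrow> \<omega> \<in> space M \<Longrightarrow> Z s (\<theta> t \<omega>) = Z (s + t) \<omega>"
    and markov:
      "\<And>z s t A B. z \<in> S \<Longrightarrow> 0 \<le> s \<Longrightarrow> 0 \<le> t \<Longrightarrow> A \<in> sets (Ft t) \<Longrightarrow> B \<in> sets (borel_on S) \<Longrightarrow>
        emeasure (Pr z) {\<omega> \<in> A. \<exists>y\<in>B. Z (t + s) \<omega> = Some y} =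
        (\<integral>\<^sup>+\<omega>\<in>A. at_state (\<lambda>y. emeasure (Q s y) B) (Z t \<omega>) \<partial>Pr z)"

definition law_from :: "('s \<Rightarrow> 'w measure) \<Rightarrow> 'w measure \<Rightarrow> 's measure \<Rightarrow> 'w measure" where
  "law_from Pr M \<mu> =
     measure_of (space M) (sets M) (\<lambda>A. \<integral>\<^sup>+z. emeasure (Pr z) A \<partial>completion \<mu>)"

locale right_process = markov_process S Q M Ft Z \<theta> Pr
  for S :: "'s::topological_space set" and Q and M :: "'w measure" and Ft Z \<theta> Pr +
  assumes normal: "\<And>z. z \<in> S \<Longrightarrow> AE \<omega> in Pr z. Z 0 \<omega> = Some z"
    and right_continuous_Ft: "\<And>t. 0 \<le> t \<Longrightarrow> sets (Ft t) = (\<Inter>u\<in>{t<..}. sets (Ft u))"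
    and universally_augmented_Ft:
      "\<And>t. 0 \<le> t \<Longrightarrow>
        sets (Ft t) = (\<Inter>\<mu>\<in>{\<mu>. prob_space \<mu> \<and> sets \<mu> = sets (borel_on S)}.
          sigma_sets (space M) (sets (Ft t) \<union> null_sets (completion (law_from Pr M \<mu>))))"
    and right_continuous_paths:
      "\<And>z. z \<in> S \<Longrightarrow> AE \<omega> in Pr z. right_continuous_from 0 (\<lambda>t. Z t \<omega>)"
    and right_continuous_excessive:
      "\<And>q f z. 0 < q \<Longrightarrow> excessive S Q q f \<Longrightarrow> z \<in> S \<Longrightarrow>
        AE \<omega> in Pr z. \<forall>t\<ge>0. ((\<lambda>u. at_state f (Z u \<omega>)) \<longlongrightarrow> at_state f (Z t \<omega>)) (at_right t)"

locale cadlag_right_process = right_process S Q M Ft Z \<theta> Pr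
  for S :: "'s::topological_space set" and Q and M :: "'w measure" and Ft Z \<theta> Pr +
  assumes left_limits: "\<And>z. z \<in> S \<Longrightarrow> AE \<omega> in Pr z. left_limits_from S 0 (\<lambda>t. Z t \<omega>)"

text \<open>A non-homogeneous Markov process has a law \<open>Pr s x\<close> for each starting time \<open>s\<close> and starting
  point \<open>x\<close>; the Markov property is with respect to the natural filtration after time \<open>s\<close>.\<close>

locale nonhom_cadlag_markov_process =
  fixes P :: "real \<Rightarrow> real \<Rightarrow> 'e::topological_space \<Rightarrow> 'e measure"
    and M :: "'v measure"
    and X :: "real \<Rightarrow> 'v \<Rightarrow> 'e option"
    and Pr :: "real \<Rightarrow> 'e \<Rightarrow> 'v measure"
  assumes transition_function: "nonhom_transition_function P"
    and sets_Pr: "\<And>s x. 0 \<le> s \<Longrightarrow> sets (Pr s x) = sets M"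
    and prob_space_Pr: "\<And>s x. 0 \<le> s \<Longrightarrow> prob_space (Pr s x)"
    and measurable:
      "\<And>t B. 0 \<le> t \<Longrightarrow> B \<in> sets borel \<Longrightarrow> {\<omega> \<in> space M. \<exists>y\<in>B. X t \<omega> = Some y} \<in> sets M"
    and start: "\<And>s x. 0 \<le> s \<Longrightarrow> AE \<omega> in Pr s x. X s \<omega> = Some x"
    and absorbed: "\<And>s x. 0 \<le> s \<Longrightarrow> AE \<omega> in Pr s x. absorbed_from s (\<lambda>t. X t \<omega>)"
    and cadlag:
      "\<And>s x. 0 \<le> s \<Longrightarrow>
        AE \<omega> in Pr s x. right_continuous_from s (\<lambda>t. X t \<omega>) \<and>
                         left_limits_from UNIV s (\<lambda>t. X t \<omega>)"
    and markov:
      "\<And>s t u x A B. 0 \<le> s \<Longrightarrow> s \<le> t \<Longrightarrow> t \<le> u \<Longrightarrow> B \<in> sets borel \<Longrightarrow>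
        A \<in> sigma_sets (space M)
              {{\<omega> \<in> space M. \<exists>y\<in>C. X r \<omega> = Some y} | r C. s \<le> r \<and> r \<le> t \<and> C \<in> sets borel} \<Longrightarrow>
        emeasure (Pr s x) {\<omega> \<in> A. \<exists>y\<in>B. X u \<omega> = Some y} =
        (\<integral>\<^sup>+\<omega>\<in>A. at_state (\<lambda>y. emeasure (P t u y) B) (X t \<omega>) \<partial>Pr s x)"


section \<open>Diffusions in an open set\<close>

definition hitting_time :: "(real \<Rightarrow> 'w \<Rightarrow> 's option) \<Rightarrow> 's set \<Rightarrow> 'w \<Rightarrow> ereal" where
  "hitting_time Z A \<omega> = Inf {ereal t | t. 0 < t \<and> (\<exists>y\<in>A. Z t \<omega> = Some y)}"

text \<open>The random time \<open>R + T\<^sub>A \<circ> \<theta>\<^sub>R\<close>, infinite where \<open>R\<close> is.\<close>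

definition hitting_time_after ::
    "(real \<Rightarrow> 'w \<Rightarrow> 's option) \<Rightarrow> (real \<Rightarrow> 'w \<Rightarrow> 'w) \<Rightarrow> 's set \<Rightarrow> ('w \<Rightarrow> ereal) \<Rightarrow> 'w \<Rightarrow> ereal" where
  "hitting_time_after Z \<theta> A R \<omega> =
     (if R \<omega> = \<infinity> then \<infinity> else R \<omega> + hitting_time Z A (\<theta> (real_of_ereal (R \<omega>)) \<omega>))"

text \<open>Successive entrance times into \<open>A\<close> and exit times into \<open>B\<close>; the index \<open>k\<close> starts at \<open>0\<close>.\<close>

primrec entrance_time ::
    "(real \<Rightarrow> 'w \<Rightarrow> 's option) \<Rightarrow> (real \<Rightarrow> 'w \<Rightarrow> 'w) \<Rightarrow> 's set \<Rightarrow> 's set \<Rightarrow> nat \<Rightarrow> 'w \<Rightarrow> ereal" where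
  "entrance_time Z \<theta> A B 0 = hitting_time Z A"
| "entrance_time Z \<theta> A B (Suc k) =
     hitting_time_after Z \<theta> A (hitting_time_after Z \<theta> B (entrance_time Z \<theta> A B k))"

definition exit_time ::
    "(real \<Rightarrow> 'w \<Rightarrow> 's option) \<Rightarrow> (real \<Rightarrow> 'w \<Rightarrow> 'w) \<Rightarrow> 's set \<Rightarrow> 's set \<Rightarrow> nat \<Rightarrow> 'w \<Rightarrow> ereal" where
  "exit_time Z \<theta> A B k = hitting_time_after Z \<theta> B (entrance_time Z \<theta> A B k)"

definition excursion_set ::
    "'s set \<Rightarrow> (real \<Rightarrow> 'w \<Rightarrow> 's option) \<Rightarrow> (real \<Rightarrow> 'w \<Rightarrow> 'w) \<Rightarrow> 's set \<Rightarrow> (nat \<Rightarrow> 's set) \<Rightarrow> 'w \<Rightarrow> real set" where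
  "excursion_set S Z \<theta> G Gn \<omega> =
     (\<Union>n k. {t. entrance_time Z \<theta> (Gn n) (S - G) k \<omega> < ereal t \<and>
                 ereal t < exit_time Z \<theta> (Gn n) (S - G) k \<omega>})"

definition exhaustion :: "'s::topological_space set \<Rightarrow> 's set \<Rightarrow> (nat \<Rightarrow> 's set) \<Rightarrow> bool" where
  "exhaustion S G Gn \<longleftrightarrow>
     (\<forall>n. openin (top_of_set S) (Gn n) \<and> Gn n \<subseteq> G \<and>
          (top_of_set S) closure_of Gn n \<subseteq> Gn (Suc n)) \<and>
     (\<Union>n. Gn n) = G"

text \<open>Every open subset of a metrizable space has an exhaustion, and up to the lifetime the
  excursion set of a path with right continuity and left limits does not depend on it;
  the definition asks for continuity with respect to each of them.\<close>

definition diffusion_in ::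
    "'s::topological_space set \<Rightarrow> (real \<Rightarrow> 'w \<Rightarrow> 's option) \<Rightarrow> (real \<Rightarrow> 'w \<Rightarrow> 'w) \<Rightarrow>
     ('s \<Rightarrow> 'w measure) \<Rightarrow> 's set \<Rightarrow> bool" where
  "diffusion_in S Z \<theta> Pr G \<longleftrightarrow>
     (\<forall>Gn. exhaustion S G Gn \<longrightarrow>
       (\<forall>z\<in>S. AE \<omega> in Pr z.
          continuous_on {t \<in> excursion_set S Z \<theta> G Gn \<omega>. 0 \<le> t \<and> ereal t < lifetime Z \<omega>}
            (\<lambda>t. the (Z t \<omega>))))"


section \<open>Space-time process and parabolic operator\<close>

definition space_time :: "('e \<times> real) set" where
  "space_time = UNIV \<times> {0..}"

text \<open>Integrating \<open>F\<close> against \<open>spacetime_kernel P t (x, s)\<close> gives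
  \<open>Q\<^sub>t F (x, s) = P\<^sub>s\<^sub>,\<^sub>s\<^sub>+\<^sub>t (F (\<cdot>, s + t)) (x)\<close>.\<close>

definition spacetime_kernel ::
    "(real \<Rightarrow> real \<Rightarrow> 'e::topological_space \<Rightarrow> 'e measure) \<Rightarrow>
     real \<Rightarrow> 'e \<times> real \<Rightarrow> ('e \<times> real) measure" where
  "spacetime_kernel P t = (\<lambda>(x, s). distr (P s (s + t) x) (borel_on space_time) (\<lambda>y. (y, s + t)))"

definition diff_quotient ::
    "(real \<Rightarrow> real \<Rightarrow> 'e \<Rightarrow> 'e measure) \<Rightarrow> real \<Rightarrow> ('e \<Rightarrow> real) \<Rightarrow> 'e \<Rightarrow> real \<Rightarrow> real" where
  "diff_quotient P s f x t = ((\<integral>y. f y \<partial>P s (s + t) x) - f x) / t"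

text \<open>The operators \<open>L\<^sub>s\<close>; only meaningful at points where the limit exists.\<close>

definition gen_L ::
    "(real \<Rightarrow> real \<Rightarrow> 'e \<Rightarrow> 'e measure) \<Rightarrow> real \<Rightarrow> ('e \<Rightarrow> real) \<Rightarrow> 'e \<Rightarrow> real" where
  "gen_L P s f x = Lim (at_right 0) (diff_quotient P s f x)"

definition parabolic_domain ::
    "(real \<Rightarrow> real \<Rightarrow> 'e::topological_space \<Rightarrow> 'e measure) \<Rightarrow> real \<Rightarrow> ('e \<times> real \<Rightarrow> real) set" where
  "parabolic_domain P \<alpha> =
     {F. F \<in> borel_measurable (borel_on space_time) \<and> bounded (F ` space_time) \<and>
         (\<exists>D. (\<forall>x. \<forall>s\<ge>0. ((\<lambda>r. F (x, r)) has_real_derivative D (x, s)) (at s within {0..})) \<and>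
              bounded (D ` space_time)) \<and>
         ae_for space_time (spacetime_kernel P)
           (\<lambda>(x, s). \<exists>l. (diff_quotient P s (\<lambda>y. F (y, s)) x \<longlongrightarrow> l) (at_right 0)) \<and>
         (\<exists>V :: 'e \<times> real \<Rightarrow> ennreal.
            V \<in> borel_measurable (borel_on space_time) \<and>
            (\<forall>z\<in>space_time. resolvent (spacetime_kernel P) \<alpha> V z < \<infinity>) \<and>
            (\<forall>t>0. ae_for space_time (spacetime_kernel P)
               (\<lambda>z. ennreal \<bar>((\<integral>w. F w \<partial>spacetime_kernel P t z) - F z) / t\<bar> \<le> V z)))}"

end

theory Submission
  imports Defs
begin

text \<open>
  Inside an excursion, a discontinuity at time \<open>t\<^sub>0\<close> is a jump from the closure of \<open>G\<close> to a different
  point of \<open>G\<close>, because the time component is deterministic. By separation some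
  \<open>u = \<phi>\<^sub>k(f\<^sub>n - \<epsilon>)\<close> with rational \<open>\<epsilon>\<close> vanishes on the open set \<open>U = {f\<^sub>n < \<epsilon>} \<inter> G\<close>, which contains the
  path just before \<open>t\<^sub>0\<close>, and is bounded away from \<open>0\<close> along the path just after \<open>t\<^sub>0\<close>. On such a path
  \<open>(1/h) \<integral> e\<^sup>-\<^sup>\<alpha>\<^sup>t 1\<^sub>U(Z\<^sub>t) u(Z\<^sub>t\<^sub>+\<^sub>h) dt\<close> stays bounded below as \<open>h \<rightarrow> 0\<close>. By the Markov property at
  time \<open>t\<close> its expectation is \<open>\<integral> e\<^sup>-\<^sup>\<alpha>\<^sup>t E[1\<^sub>U (Q\<^sub>hu - u)/h (Z\<^sub>t)] dt\<close>, which tends to \<open>0\<close> by dominated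
  convergence, since the generator annihilates \<open>u\<close> on \<open>U\<close>; so Fatou's lemma excludes the jump.
  Only the simple Markov property is needed.
\<close>

section \<open>Metrizability and continuous functions along paths\<close>

text \<open>The function is the distance to the complement of \<open>W\<close>. Such functions turn
  open sets of states into conditions on real-valued functions of the path, whose measurability
  follows from right continuity.\<close>

lemma metrizable_open_eq_positive:
  fixes W :: "'s::topological_space set"
  assumes "metrizable_space (euclidean :: 's topology)" and "open W"
  obtains w :: "'s \<Rightarrow> real" where "continuous_on UNIV w" "W = {x. 0 < w x}"
proof (cases "W = UNIV")
  case True
  \<comment> \<open>The case of the whole space is separate because the infimum defining the
    distance would run over the empty set.\<close>
  show ?thesis
    by (rule that[of "\<lambda>_. 1"]) (simp_all add: True)
next
  case False
  obtain D d where "Metric_space D d" and top: "(euclidean :: 's topology) = Metric_space.mtopology D d"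
    using assms(1) unfolding metrizable_space_def by blast
  moreover from this have "D = UNIV"
    by (metis Metric_space.topspace_mtopology topspace_euclidean)
  ultimately interpret Metric_space UNIV d
    by simp
  have top: "(euclidean :: 's topology) = mtopology"
    using top \<open>D = UNIV\<close> by simp
  have open_iff: "open U \<longleftrightarrow> (\<forall>x\<in>U. \<exists>r>0. mball x r \<subseteq> U)" for U :: "'s set"
    unfolding open_openin top openin_mtopology by auto
  have open_mball: "open (mball x r)" for x r
    unfolding open_openin top by (rule openin_mball)
  define w where "w x = (INF y\<in>- W. d x y)" for x
  have bdd: "bdd_below (d x ` A)" for x A
    by (rule bdd_belowI[of _ 0]) auto
  have ne: "- W \<noteq> {}"
    using False by auto
  have lip: "w x \<le> d x x' + w x'" for x x'
  proof -
    have "w x - d x x' \<le> w x'"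
      unfolding w_def[of x']
    proof (rule cINF_greatest[OF ne])
      fix y assume "y \<in> - W"
      then have "w x \<le> d x y"
        unfolding w_def by (rule cINF_lower[OF bdd])
      also have "\<dots> \<le> d x x' + d x' y"
        by (rule triangle) auto
      finally show "w x - d x x' \<le> d x' y"
        by simp
    qed
    then show ?thesis
      by simp
  qed
  have "continuous_on UNIV w"
    unfolding continuous_on_def
  proof (rule ballI)
    fix x :: 's
    show "(w \<longlongrightarrow> w x) (at x within UNIV)"
    proof (rule tendstoI)
      fix e :: real assume "0 < e"
      have "\<forall>\<^sub>F y in nhds x. y \<in> mball x e"
        by (rule eventually_nhds_in_open) (use \<open>0 < e\<close> in \<open>simp_all add: open_mball\<close>)
      then have "\<forall>\<^sub>F y in at x. y \<in> mball x e"
        by (simp add: eventually_at_filter eventually_mono)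
      then show "\<forall>\<^sub>F y in at x. dist (w y) (w x) < e"
      proof eventually_elim
        case (elim y)
        then show ?case
          using lip[of x y] lip[of y x] commute[of x y] by (simp add: dist_real_def)
      qed
    qed
  qed
  moreover have "W = {x. 0 < w x}"
  proof (intro set_eqI iffI)
    fix x assume "x \<in> W"
    then obtain r where r: "0 < r" "mball x r \<subseteq> W"
      using \<open>open W\<close> open_iff by blast
    have "r \<le> w x"
      unfolding w_def
      by (rule cINF_greatest[OF ne]) (use r in \<open>force simp: not_less[symmetric]\<close>)
    with r show "x \<in> {x. 0 < w x}"
      by simp
  next
    fix x assume x: "x \<in> {x. 0 < w x}"
    show "x \<in> W"
    proof (rule ccontr)
      assume "x \<notin> W"
      then have "w x \<le> d x x"
        unfolding w_def by (intro cINF_lower[OF bdd]) auto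
      with x show False
        by simp
    qed
  qed
  ultimately show ?thesis
    by (rule that)
qed

lemma lusin_space_imp_metrizable: "lusin_space X \<Longrightarrow> metrizable_space X"
  unfolding lusin_space_def
  using homeomorphic_metrizable_space metrizable_space_subtopology by blast

text \<open>Convergence to a state forces the path to be alive eventually along the filter, so the
  value 0 assigned at the cemetery does not interfere.\<close>

lemma path_tendsto_compose:
  assumes "path_tendsto p z Fl" and "continuous_on UNIV w"
  shows "((\<lambda>u. at_state w (p u)) \<longlongrightarrow> w z) Fl"
proof (rule topological_tendstoI)
  fix U assume "open U" "w z \<in> U"
  then have "open (w -` U)" "z \<in> w -` U"
    using assms(2) by (auto simp: continuous_on_open_vimage)
  then have "\<forall>\<^sub>F u in Fl. \<exists>y\<in>w -` U. p u = Some y"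
    using assms(1) unfolding path_tendsto_def by blast
  then show "\<forall>\<^sub>F u in Fl. at_state w (p u) \<in> U"
    by eventually_elim auto
qed

section \<open>The simple Markov property for nonnegative Borel functions\<close>

context markov_process
begin

lemma state_measurable:
  assumes "0 \<le> t" and "B \<in> sets (borel_on S)"
  shows "{\<omega> \<in> space M. \<exists>y\<in>B. Z t \<omega> = Some y} \<in> sets M"
  using adapted[OF assms] subalgebra_Ft[OF assms(1)] by (auto simp: subalgebra_def)

lemma sets_borel_on_S: "S \<in> sets (borel_on S)"
  using sets.top[of "borel_on S"] by (simp add: space_restrict_space)

lemma alive_measurable:
  assumes "0 \<le> t"
  shows "{\<omega> \<in> space M. Z t \<omega> \<noteq> None} \<in> sets M"
proof -
  have "{\<omega> \<in> space M. Z t \<omega> \<noteq> None} = {\<omega> \<in> space M. \<exists>y\<in>S. Z t \<omega> = Some y}"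
    using state_space[OF assms] by auto
  then show ?thesis
    using state_measurable[OF assms sets_borel_on_S] by simp
qed

lemma at_state_measurable:
  assumes "0 \<le> t" and g: "g \<in> borel_measurable (borel_on S)"
  shows "(\<lambda>\<omega>. at_state g (Z t \<omega>)) \<in> borel_measurable M"
proof (rule borel_measurableI)
  fix W :: "ennreal set" assume "open W"
  let ?B = "g -` W \<inter> S" and ?alive = "{\<omega> \<in> space M. Z t \<omega> \<noteq> None}"
  have B: "?B \<in> sets (borel_on S)"
    using measurable_sets[OF g borel_open[OF \<open>open W\<close>]] by (simp add: space_restrict_space)
  \<comment> \<open>The cemetery carries the value 0, so dead paths belong to the preimage exactly
    when 0 is in \<open>W\<close>.\<close>
  have "(\<lambda>\<omega>. at_state g (Z t \<omega>)) -` W \<inter> space M =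
      {\<omega> \<in> space M. \<exists>y\<in>?B. Z t \<omega> = Some y} \<union> (if 0 \<in> W then space M - ?alive else {})"
    using state_space[OF assms(1)] by (auto split: option.splits if_splits)
  also have "\<dots> \<in> sets M"
    using state_measurable[OF assms(1) B] alive_measurable[OF assms(1)] by auto
  finally show "(\<lambda>\<omega>. at_state g (Z t \<omega>)) -` W \<inter> space M \<in> sets M" .
qed

lemma kernel_measurable:
  assumes "0 \<le> t" and [measurable]: "g \<in> borel_measurable (borel_on S)"
  shows "(\<lambda>y. \<integral>\<^sup>+w. g w \<partial>Q t y) \<in> borel_measurable (borel_on S)"
proof -
  have [measurable]: "Q t \<in> borel_on S \<rightarrow>\<^sub>M subprob_algebra (borel_on S)"
    using transition_function assms(1) unfolding transition_function_def by blast
  show ?thesis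
    by measurable
qed

lemma sets_kernel: "0 \<le> t \<Longrightarrow> y \<in> S \<Longrightarrow> sets (Q t y) = sets (borel_on S)"
  using transition_function measurable_space[of "Q t" "borel_on S" "subprob_algebra (borel_on S)" y]
  unfolding transition_function_def by (simp add: space_restrict_space space_subprob_algebra)

text \<open>Passage from indicators to nonnegative Borel functions by the usual induction: both
  sides are additive, homogeneous and continuous along increasing sequences.\<close>

lemma nn_integral_markov:
  assumes "z \<in> S" "0 \<le> s" "0 \<le> t" and A: "A \<in> sets (Ft t)" and g: "g \<in> borel_measurable (borel_on S)"
  shows "(\<integral>\<^sup>+\<omega>\<in>A. at_state g (Z (t + s) \<omega>) \<partial>Pr z) =
         (\<integral>\<^sup>+\<omega>\<in>A. at_state (\<lambda>y. \<integral>\<^sup>+w. g w \<partial>Q s y) (Z t \<omega>) \<partial>Pr z)"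
proof -
  have [measurable_cong]: "sets (Pr z) = sets M"
    by (rule sets_Pr) fact
  have A'[measurable]: "A \<in> sets M"
    using A subalgebra_Ft[OF \<open>0 \<le> t\<close>] by (auto simp: subalgebra_def)
  have [measurable]: "(\<lambda>\<omega>. at_state g (Z (t + s) \<omega>)) \<in> borel_measurable M"
      "(\<lambda>\<omega>. at_state (\<lambda>y. \<integral>\<^sup>+w. g w \<partial>Q s y) (Z t \<omega>)) \<in> borel_measurable M"
    if "g \<in> borel_measurable (borel_on S)" for g
    using that assms by (simp_all add: at_state_measurable kernel_measurable)
  have AM: "\<omega> \<in> space M" if "\<omega> \<in> A" for \<omega>
    using that sets.sets_into_space[OF A'] by blast
  have meas_Q: "h \<in> borel_measurable (Q s y)" if "h \<in> borel_measurable (borel_on S)" "y \<in> S" for h :: "_ \<Rightarrow> ennreal" and y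
    using that sets_kernel[OF \<open>0 \<le> s\<close>] by (simp cong: measurable_cong_sets)
  show ?thesis
    using g
  proof (induction rule: borel_measurable_induct)
    case (cong f g)
    \<comment> \<open>The two functions agree only on \<open>S\<close>; this suffices because paths
      in \<open>A\<close> take their values there while alive.\<close>
    have "at_state f (Z (t + s) \<omega>) = at_state g (Z (t + s) \<omega>)" if "\<omega> \<in> A" for \<omega>
      using state_space[of "t + s" \<omega>] cong(3) AM[OF that] assms
      by (auto split: option.splits simp: space_restrict_space)
    then have 1: "(\<integral>\<^sup>+\<omega>\<in>A. at_state f (Z (t + s) \<omega>) \<partial>Pr z) = (\<integral>\<^sup>+\<omega>\<in>A. at_state g (Z (t + s) \<omega>) \<partial>Pr z)"
      by (intro nn_integral_cong) (auto simp: indicator_def)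
    have "at_state (\<lambda>y. \<integral>\<^sup>+w. f w \<partial>Q s y) (Z t \<omega>) = at_state (\<lambda>y. \<integral>\<^sup>+w. g w \<partial>Q s y) (Z t \<omega>)"
      if "\<omega> \<in> A" for \<omega>
      using state_space[of t \<omega>] AM[OF that] assms
      by (auto split: option.splits intro!: nn_integral_cong cong(3)
          simp: sets_eq_imp_space_eq[OF sets_kernel])
    then have 2: "(\<integral>\<^sup>+\<omega>\<in>A. at_state (\<lambda>y. \<integral>\<^sup>+w. f w \<partial>Q s y) (Z t \<omega>) \<partial>Pr z) =
        (\<integral>\<^sup>+\<omega>\<in>A. at_state (\<lambda>y. \<integral>\<^sup>+w. g w \<partial>Q s y) (Z t \<omega>) \<partial>Pr z)"
      by (intro nn_integral_cong) (auto simp: indicator_def)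
    from 1 2 cong(4) show ?case
      by simp
  next
    \<comment> \<open>Here the Markov property of the locale enters; the remaining cases are limits
      and linear combinations.\<close>
    case (set B)
    have C: "{\<omega> \<in> A. \<exists>y\<in>B. Z (t + s) \<omega> = Some y} \<in> sets M"
    proof -
      have "{\<omega> \<in> A. \<exists>y\<in>B. Z (t + s) \<omega> = Some y} = A \<inter> {\<omega> \<in> space M. \<exists>y\<in>B. Z (t + s) \<omega> = Some y}"
        using AM by auto
      then show ?thesis
        using state_measurable[of "t + s" B] set assms(2,3) by auto
    qed
    have "(\<integral>\<^sup>+\<omega>\<in>A. at_state (indicator B) (Z (t + s) \<omega>) \<partial>Pr z) =
        (\<integral>\<^sup>+\<omega>. indicator {\<omega> \<in> A. \<exists>y\<in>B. Z (t + s) \<omega> = Some y} \<omega> \<partial>Pr z)"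
      by (intro nn_integral_cong) (auto simp: indicator_def split: option.splits)
    also have "\<dots> = emeasure (Pr z) {\<omega> \<in> A. \<exists>y\<in>B. Z (t + s) \<omega> = Some y}"
      using C by (intro nn_integral_indicator) (simp add: sets_Pr \<open>z \<in> S\<close>)
    also have "\<dots> = (\<integral>\<^sup>+\<omega>\<in>A. at_state (\<lambda>y. emeasure (Q s y) B) (Z t \<omega>) \<partial>Pr z)"
      by (rule markov) (use assms set in auto)
    also have "\<dots> = (\<integral>\<^sup>+\<omega>\<in>A. at_state (\<lambda>y. \<integral>\<^sup>+w. indicator B w \<partial>Q s y) (Z t \<omega>) \<partial>Pr z)"
    proof (rule nn_integral_cong)
      fix \<omega>
      show "at_state (\<lambda>y. emeasure (Q s y) B) (Z t \<omega>) * indicator A \<omega> =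
          at_state (\<lambda>y. \<integral>\<^sup>+w. indicator B w \<partial>Q s y) (Z t \<omega>) * indicator A \<omega>"
        using state_space[of t \<omega>] AM[of \<omega>] assms set
        by (auto split: option.splits simp: indicator_def sets_kernel)
    qed
    finally show ?case .
  next
    case (mult u c)
    have u[measurable]: "u \<in> borel_measurable (borel_on S)" by fact
    have "(\<integral>\<^sup>+\<omega>\<in>A. at_state (\<lambda>x. c * u x) (Z (t + s) \<omega>) \<partial>Pr z) =
        c * (\<integral>\<^sup>+\<omega>\<in>A. at_state u (Z (t + s) \<omega>) \<partial>Pr z)"
      by (subst nn_integral_cmult[symmetric])
        (auto intro!: nn_integral_cong simp: mult.assoc split: option.splits)
    also have "\<dots> = c * (\<integral>\<^sup>+\<omega>\<in>A. at_state (\<lambda>y. \<integral>\<^sup>+w. u w \<partial>Q s y) (Z t \<omega>) \<partial>Pr z)"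
      by (simp add: mult)
    also have "\<dots> = (\<integral>\<^sup>+\<omega>\<in>A. at_state (\<lambda>y. \<integral>\<^sup>+w. c * u w \<partial>Q s y) (Z t \<omega>) \<partial>Pr z)"
    proof (subst nn_integral_cmult[symmetric])
      show "(\<integral>\<^sup>+\<omega>. c * (at_state (\<lambda>y. \<integral>\<^sup>+w. u w \<partial>Q s y) (Z t \<omega>) * indicator A \<omega>) \<partial>Pr z) =
          (\<integral>\<^sup>+\<omega>\<in>A. at_state (\<lambda>y. \<integral>\<^sup>+w. c * u w \<partial>Q s y) (Z t \<omega>) \<partial>Pr z)"
        using state_space[OF \<open>0 \<le> t\<close> AM]
        by (intro nn_integral_cong)
          (auto 4 4 split: option.splits simp: indicator_def nn_integral_cmult meas_Q u)
    qed measurable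
    finally show ?case .
  next
    case (add u v)
    have uv[measurable]: "u \<in> borel_measurable (borel_on S)" "v \<in> borel_measurable (borel_on S)" by fact+
    have "(\<integral>\<^sup>+\<omega>\<in>A. at_state (\<lambda>x. v x + u x) (Z (t + s) \<omega>) \<partial>Pr z) =
        (\<integral>\<^sup>+\<omega>\<in>A. at_state v (Z (t + s) \<omega>) \<partial>Pr z) + (\<integral>\<^sup>+\<omega>\<in>A. at_state u (Z (t + s) \<omega>) \<partial>Pr z)"
      by (subst nn_integral_add[symmetric])
        (auto intro!: nn_integral_cong simp: distrib_right split: option.splits)
    also have "\<dots> = (\<integral>\<^sup>+\<omega>\<in>A. at_state (\<lambda>y. \<integral>\<^sup>+w. v w \<partial>Q s y) (Z t \<omega>) \<partial>Pr z) +
        (\<integral>\<^sup>+\<omega>\<in>A. at_state (\<lambda>y. \<integral>\<^sup>+w. u w \<partial>Q s y) (Z t \<omega>) \<partial>Pr z)"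
      by (simp add: add)
    also have "\<dots> = (\<integral>\<^sup>+\<omega>\<in>A. at_state (\<lambda>y. \<integral>\<^sup>+w. v w + u w \<partial>Q s y) (Z t \<omega>) \<partial>Pr z)"
    proof (subst nn_integral_add[symmetric])
      show "(\<integral>\<^sup>+\<omega>. at_state (\<lambda>y. \<integral>\<^sup>+w. v w \<partial>Q s y) (Z t \<omega>) * indicator A \<omega> +
            at_state (\<lambda>y. \<integral>\<^sup>+w. u w \<partial>Q s y) (Z t \<omega>) * indicator A \<omega> \<partial>Pr z) =
          (\<integral>\<^sup>+\<omega>\<in>A. at_state (\<lambda>y. \<integral>\<^sup>+w. v w + u w \<partial>Q s y) (Z t \<omega>) \<partial>Pr z)"
        using state_space[OF \<open>0 \<le> t\<close> AM]
        by (intro nn_integral_cong)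
          (auto 4 4 split: option.splits simp: indicator_def nn_integral_add meas_Q uv)
    qed measurable
    finally show ?case .
  next
    case (seq U)
    have U[measurable]: "U i \<in> borel_measurable (borel_on S)" for i by fact
    have mono: "i \<le> j \<Longrightarrow> U i x \<le> U j x" for i j x
      using \<open>incseq U\<close> by (auto simp: incseq_def le_fun_def)
    have "(\<integral>\<^sup>+\<omega>\<in>A. at_state (Sup (range U)) (Z (t + s) \<omega>) \<partial>Pr z) =
        (\<integral>\<^sup>+\<omega>. (SUP i. at_state (U i) (Z (t + s) \<omega>) * indicator A \<omega>) \<partial>Pr z)"
      by (intro nn_integral_cong) (auto split: option.splits simp: SUP_mult_right_ennreal[symmetric] image_comp)
    also have "\<dots> = (SUP i. \<integral>\<^sup>+\<omega>\<in>A. at_state (U i) (Z (t + s) \<omega>) \<partial>Pr z)"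
      by (rule nn_integral_monotone_convergence_SUP)
        (auto simp: incseq_def le_fun_def mono intro!: mult_right_mono split: option.splits)
    also have "\<dots> = (SUP i. \<integral>\<^sup>+\<omega>\<in>A. at_state (\<lambda>y. \<integral>\<^sup>+w. U i w \<partial>Q s y) (Z t \<omega>) \<partial>Pr z)"
      by (simp add: seq)
    also have "\<dots> = (\<integral>\<^sup>+\<omega>. (SUP i. at_state (\<lambda>y. \<integral>\<^sup>+w. U i w \<partial>Q s y) (Z t \<omega>) * indicator A \<omega>) \<partial>Pr z)"
      by (rule nn_integral_monotone_convergence_SUP[symmetric])
        (auto simp: incseq_def le_fun_def mono intro!: mult_right_mono nn_integral_mono split: option.splits)
    also have "\<dots> = (\<integral>\<^sup>+\<omega>\<in>A. at_state (\<lambda>y. \<integral>\<^sup>+w. Sup (range U) w \<partial>Q s y) (Z t \<omega>) \<partial>Pr z)"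
    proof (rule nn_integral_cong)
      fix \<omega>
      have Sup_U: "Sup (range U) = (\<lambda>w. SUP i. U i w)"
        by (simp add: fun_eq_iff image_comp)
      have "(SUP i. integral\<^sup>N (Q s y) (U i)) = integral\<^sup>N (Q s y) (Sup (range U))" if "y \<in> S" for y
        unfolding Sup_U
        by (rule nn_integral_monotone_convergence_SUP[symmetric])
          (use that assms \<open>incseq U\<close> in \<open>auto simp: meas_Q U\<close>)
      then show "(SUP i. at_state (\<lambda>y. \<integral>\<^sup>+w. U i w \<partial>Q s y) (Z t \<omega>) * indicator A \<omega>) =
          at_state (\<lambda>y. \<integral>\<^sup>+w. Sup (range U) w \<partial>Q s y) (Z t \<omega>) * indicator A \<omega>"
        using state_space[of t \<omega>] AM[of \<omega>] assms
        by (auto split: option.splits simp: indicator_def)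
    qed
    finally show ?case .
  qed
qed

text \<open>
  Paths are right continuous only almost surely; discarding an exceptional set \<open>N\<close> (and negative
  times) makes functions of the state jointly measurable in time and \<open>\<omega>\<close>.
\<close>

definition masked :: "'w set \<Rightarrow> ('s \<Rightarrow> ennreal) \<Rightarrow> real \<times> 'w \<Rightarrow> ennreal" where
  "masked N g = (\<lambda>(t, \<omega>). if 0 \<le> t \<and> \<omega> \<notin> N then at_state g (Z t \<omega>) else 0)"

lemma space_Pr: "z \<in> S \<Longrightarrow> space (Pr z) = space M"
  by (rule sets_eq_imp_space_eq) (rule sets_Pr)

end

section \<open>Occupation integrals over time and paths\<close>

context right_process
begin

text \<open>This is the Markov property at time 0 with the sure event; normality identifies the
  state at time 0.\<close>

lemma nn_integral_state:
  assumes "z \<in> S" "0 \<le> t" and g: "g \<in> borel_measurable (borel_on S)"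
  shows "(\<integral>\<^sup>+\<omega>. at_state g (Z t \<omega>) \<partial>Pr z) = (\<integral>\<^sup>+y. g y \<partial>Q t z)"
proof -
  interpret P: prob_space "Pr z"
    by (rule prob_space_Pr) fact
  have sp: "space (Ft 0) = space M"
    using subalgebra_Ft[of 0] by (simp add: subalgebra_def)
  have "(\<integral>\<^sup>+\<omega>. at_state g (Z t \<omega>) \<partial>Pr z) = (\<integral>\<^sup>+\<omega>\<in>space M. at_state g (Z (0 + t) \<omega>) \<partial>Pr z)"
    by (intro nn_integral_cong) (simp add: space_Pr[OF assms(1)])
  also have "\<dots> = (\<integral>\<^sup>+\<omega>\<in>space M. at_state (\<lambda>y. \<integral>\<^sup>+w. g w \<partial>Q t y) (Z 0 \<omega>) \<partial>Pr z)"
    by (rule nn_integral_markov) (use assms sets.top[of "Ft 0"] sp in auto)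
  also have "\<dots> = (\<integral>\<^sup>+\<omega>. (\<integral>\<^sup>+y. g y \<partial>Q t z) \<partial>Pr z)"
    using normal[OF assms(1)] AE_space
    by (intro nn_integral_cong_AE, eventually_elim) (simp add: space_Pr[OF assms(1)])
  finally show ?thesis
    by (simp add: P.emeasure_space_1)
qed

text \<open>
  By metrizability an open set is \<open>{w > 0}\<close> for a continuous \<open>w\<close>, and \<open>w(Z\<^sub>t)\<close> is a limit of its
  discretizations from the right.
\<close>

lemma masked_measurable_exists:
  assumes metr: "metrizable_space (euclidean :: 's topology)" and z: "z \<in> S"
  obtains N where "N \<in> null_sets (Pr z)"
    and "\<forall>g\<in>borel_measurable (borel_on S). masked N g \<in> borel_measurable (lborel \<Otimes>\<^sub>M Pr z)"
proof -
  obtain N where rc: "{\<omega> \<in> space (Pr z). \<not> right_continuous_from 0 (\<lambda>t. Z t \<omega>)} \<subseteq> N"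
    and N0: "emeasure (Pr z) N = 0" and N[measurable]: "N \<in> sets (Pr z)"
    using right_continuous_paths[OF z] by (rule AE_E)
  have [measurable_cong]: "sets (Pr z) = sets M"
    by (rule sets_Pr) fact
  let ?L = "(lborel :: real measure) \<Otimes>\<^sub>M Pr z"
  have cont: "masked N (\<lambda>x. ennreal (w x)) \<in> borel_measurable ?L" if w: "continuous_on UNIV w" for w :: "'s \<Rightarrow> real"
  proof -
    define w' where "w' x = ennreal (w x)" for x
    have w': "continuous_on UNIV w'"
      unfolding w'_def by (rule continuous_on_ennreal[OF w])
    have [measurable]: "(\<lambda>\<omega>. at_state w' (Z t \<omega>)) \<in> borel_measurable M" if "0 \<le> t" for t
      by (rule at_state_measurable[OF that])
        (intro measurable_restrict_space1 borel_measurable_continuous_onI w')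
    \<comment> \<open>\<open>r m t\<close> is the first point of the grid of mesh
      \<open>1 / Suc m\<close> strictly after \<open>t\<close>. Strictness makes
      \<open>r m t\<close> approach \<open>t\<close> from the right, where the path is
      continuous.\<close>
    define r where "r m t = (real (nat \<lfloor>t * Suc m\<rfloor>) + 1) / Suc m" for m :: nat and t :: real
    have r: "t < r m t" "r m t \<le> t + 1 / Suc m" if "0 \<le> t" for m t
    proof -
      have "0 \<le> \<lfloor>t * Suc m\<rfloor>"
        using that by simp
      then have "real (nat \<lfloor>t * Suc m\<rfloor>) = of_int \<lfloor>t * Suc m\<rfloor>"
        by simp
      then have "t * Suc m < real (nat \<lfloor>t * Suc m\<rfloor>) + 1" "real (nat \<lfloor>t * Suc m\<rfloor>) \<le> t * Suc m"
        by linarith+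
      then show "t < r m t" "r m t \<le> t + 1 / Suc m"
        unfolding r_def by (simp_all add: field_simps del: of_nat_Suc)
    qed
    define Y where "Y m = (\<lambda>(t, \<omega>). if 0 \<le> t \<and> \<omega> \<notin> N then at_state w' (Z (r m t) \<omega>) else 0)" for m :: nat
    have Y_meas: "Y m \<in> borel_measurable ?L" for m
    proof -
      \<comment> \<open>For fixed \<open>m\<close> only countably many grid times occur, so
        measurability at each fixed time is enough.\<close>
      have "(\<lambda>x. (\<lambda>i x. at_state w' (Z ((real i + 1) / Suc m) (snd x))) (nat \<lfloor>fst x * Suc m\<rfloor>) x) \<in> borel_measurable ?L"
        by (rule measurable_compose_countable) measurable
      then have [measurable]: "(\<lambda>x. at_state w' (Z (r m (fst x)) (snd x))) \<in> borel_measurable ?L"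
        by (simp add: r_def)
      show ?thesis
        unfolding Y_def case_prod_beta by measurable
    qed
    have "masked N w' \<in> borel_measurable ?L"
    proof (rule borel_measurable_LIMSEQ_order[OF _ Y_meas])
      fix x assume "x \<in> space ?L"
      then obtain t \<omega> where x: "x = (t, \<omega>)" "\<omega> \<in> space M"
        by (auto simp: space_pair_measure space_Pr[OF z])
      show "(\<lambda>m. Y m x) \<longlonglongrightarrow> masked N w' x"
      proof (cases "0 \<le> t \<and> \<omega> \<notin> N")
        case True
        then have rcw: "right_continuous_from 0 (\<lambda>t. Z t \<omega>)"
          using rc x by (auto simp: space_Pr[OF z])
        have lim: "filterlim (\<lambda>m. r m t) (at_right t) sequentially"
        proof (rule tendsto_imp_filterlim_at_right)
          show "(\<lambda>m. r m t) \<longlonglongrightarrow> t"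
          proof (rule tendsto_sandwich[where f = "\<lambda>_. t" and h = "\<lambda>m. t + 1 / Suc m"])
            show "(\<lambda>m. t + 1 / Suc m) \<longlonglongrightarrow> t"
              using tendsto_add[OF tendsto_const LIMSEQ_inverse_real_of_nat, of t]
              by (simp add: inverse_eq_divide)
          qed (use r True in \<open>auto intro!: always_eventually less_imp_le\<close>)
        qed (use r True in auto)
        show ?thesis
        proof (cases "Z t \<omega>")
          case None
          \<comment> \<open>Right continuity is stated only at living times; at the cemetery
            absorption makes the discretized values constant.\<close>
          then have "Z (r m t) \<omega> = None" for m
            using absorbed[OF x(2)] r(1)[of t m] True unfolding absorbed_from_def
            by (meson less_imp_le)
          then show ?thesis
            using None True by (simp add: Y_def masked_def x)
        next
          case (Some y)
          then have "path_tendsto (\<lambda>t. Z t \<omega>) y (at_right t)"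
            using rcw True unfolding right_continuous_from_def by blast
          then have "((\<lambda>u. at_state w' (Z u \<omega>)) \<longlongrightarrow> w' y) (at_right t)"
            by (rule path_tendsto_compose) (rule w')
          from filterlim_compose[OF this lim] show ?thesis
            using Some True by (simp add: Y_def masked_def x)
        qed
      qed (auto simp: Y_def masked_def x)
    qed
    then show ?thesis
      unfolding w'_def .
  qed
  \<comment> \<open>On the set \<open>A\<close> of living time-path pairs the state is a genuine
    point of \<open>S\<close>. It is shown to be a Borel map on \<open>A\<close>, composed with
    \<open>g\<close>, and extended by 0.\<close>
  define A where "A = {(t, \<omega>) \<in> space ?L. 0 \<le> t \<and> \<omega> \<notin> N \<and> Z t \<omega> \<noteq> None}"
  \<comment> \<open>Positivity of the continuous function belonging to \<open>W\<close> detects both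
    that the path is alive and that it lies in \<open>W\<close>.\<close>
  have pos: "{(t, \<omega>) \<in> space ?L. 0 \<le> t \<and> \<omega> \<notin> N \<and> (\<exists>y\<in>W. Z t \<omega> = Some y)} \<in> sets ?L" if W_open: "open W" for W
  proof -
    obtain w :: "'s \<Rightarrow> real" where w: "continuous_on UNIV w" "W = {x. 0 < w x}"
      using metrizable_open_eq_positive[OF metr W_open] .
    note [measurable] = cont[OF w(1)]
    have "{x \<in> space ?L. 0 < masked N (\<lambda>x. ennreal (w x)) x} \<in> sets ?L"
      by measurable
    also have "{x \<in> space ?L. 0 < masked N (\<lambda>x. ennreal (w x)) x} =
        {(t, \<omega>) \<in> space ?L. 0 \<le> t \<and> \<omega> \<notin> N \<and> (\<exists>y\<in>W. Z t \<omega> = Some y)}"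
      by (auto simp: w(2) masked_def split: option.splits if_splits)
    finally show ?thesis .
  qed
  have A: "A \<in> sets ?L"
    using pos[of UNIV] by (simp add: A_def)
  have the_Z: "(\<lambda>(t, \<omega>). the (Z t \<omega>)) \<in> restrict_space ?L A \<rightarrow>\<^sub>M borel_on S"
  proof (rule measurable_restrict_space2)
    show "(\<lambda>(t, \<omega>). the (Z t \<omega>)) \<in> space (restrict_space ?L A) \<rightarrow> S"
      using state_space by (auto simp: A_def space_restrict_space space_pair_measure space_Pr[OF z])
    show "(\<lambda>(t, \<omega>). the (Z t \<omega>)) \<in> borel_measurable (restrict_space ?L A)"
    proof (rule borel_measurableI)
      fix W :: "'s set" assume "open W"
      have "(\<lambda>(t, \<omega>). the (Z t \<omega>)) -` W \<inter> space (restrict_space ?L A) =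
          {(t, \<omega>) \<in> space ?L. 0 \<le> t \<and> \<omega> \<notin> N \<and> (\<exists>y\<in>W. Z t \<omega> = Some y)}"
        by (auto simp: A_def space_restrict_space)
      also have "\<dots> \<in> sets (restrict_space ?L A)"
        by (subst sets_restrict_space_iff) (use A pos[OF \<open>open W\<close>] in \<open>auto simp: A_def\<close>)
      finally show "(\<lambda>(t, \<omega>). the (Z t \<omega>)) -` W \<inter> space (restrict_space ?L A) \<in> sets (restrict_space ?L A)" .
    qed
  qed
  show thesis
  proof (rule that, safe)
    show "N \<in> null_sets (Pr z)"
      using N0 N by (simp add: null_setsI)
    fix g :: "'s \<Rightarrow> ennreal" assume g: "g \<in> borel_measurable (borel_on S)"
    have "(\<lambda>x. g (case x of (t, \<omega>) \<Rightarrow> the (Z t \<omega>))) \<in> borel_measurable (restrict_space ?L A)"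
      by (rule measurable_compose[OF the_Z g])
    then have "(\<lambda>x. g (case x of (t, \<omega>) \<Rightarrow> the (Z t \<omega>)) * indicator A x) \<in> borel_measurable ?L"
      by (subst (asm) borel_measurable_restrict_space_iff_ennreal) (rule sets.Int[OF A sets.top])
    also have "?this \<longleftrightarrow> masked N g \<in> borel_measurable ?L"
      by (intro measurable_cong) (auto simp: A_def masked_def indicator_def split: option.splits if_splits)
    finally show "masked N g \<in> borel_measurable ?L" .
  qed
qed

text \<open>By Tonelli the resolvent is an integral over time and paths; the null set
  \<open>N\<close> does not change the expectation at any fixed time. This lets analytic statements
  about the resolvent be used as statements about almost every pair of time and path.\<close>

lemma resolvent_eq_masked:
  assumes z: "z \<in> S" and N: "N \<in> null_sets (Pr z)" and g: "g \<in> borel_measurable (borel_on S)"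
    and [measurable]: "masked N g \<in> borel_measurable (lborel \<Otimes>\<^sub>M Pr z)"
  shows "(\<integral>\<^sup>+x. ennreal (exp (- \<alpha> * fst x)) * masked N g x \<partial>(lborel \<Otimes>\<^sub>M Pr z)) = resolvent Q \<alpha> g z"
proof -
  interpret P: prob_space "Pr z"
    by (rule prob_space_Pr) fact
  have [measurable_cong]: "sets (Pr z) = sets M"
    by (rule sets_Pr) fact
  have "(\<integral>\<^sup>+\<omega>. ennreal (exp (- \<alpha> * t)) * masked N g (t, \<omega>) \<partial>Pr z) =
      ennreal (exp (- \<alpha> * t)) * (\<integral>\<^sup>+y. g y \<partial>Q t z) * indicator {0..} t" for t
  proof (cases "0 \<le> t")
    case True
    have [measurable]: "(\<lambda>\<omega>. at_state g (Z t \<omega>)) \<in> borel_measurable M"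
      by (rule at_state_measurable[OF True g])
    have "(\<integral>\<^sup>+\<omega>. ennreal (exp (- \<alpha> * t)) * masked N g (t, \<omega>) \<partial>Pr z) =
        (\<integral>\<^sup>+\<omega>. ennreal (exp (- \<alpha> * t)) * at_state g (Z t \<omega>) \<partial>Pr z)"
      using AE_not_in[OF N] by (intro nn_integral_cong_AE, eventually_elim) (simp add: masked_def True)
    then show ?thesis
      using True by (simp add: nn_integral_cmult nn_integral_state[OF z True g])
  qed (simp add: masked_def)
  then show ?thesis
    by (subst P.nn_integral_fst[symmetric]) (simp_all add: resolvent_def)
qed

text \<open>The resolvent of the exceptional set is the integral of a nonnegative function with a
  strictly positive exponential weight. Since it vanishes, almost no pair of time and path meets
  that set.\<close>

lemma AE_masked:
  assumes z: "z \<in> S" and N: "N \<in> null_sets (Pr z)"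
    and meas: "\<forall>g\<in>borel_measurable (borel_on S). masked N g \<in> borel_measurable (lborel \<Otimes>\<^sub>M Pr z)"
    and R: "ae_for S Q R"
  shows "AE x in lborel \<Otimes>\<^sub>M Pr z. 0 \<le> fst x \<and> snd x \<notin> N \<longrightarrow> (\<forall>y. Z (fst x) (snd x) = Some y \<longrightarrow> R y)"
proof -
  obtain B q where B: "B \<in> sets (borel_on S)" "resolvent Q q (indicator B) z = 0" "\<forall>y\<in>S - B. R y"
    using R z unfolding ae_for_def negligible_for_def by blast
  have g: "indicator B \<in> borel_measurable (borel_on S)"
    using B by simp
  note [measurable] = meas[rule_format, OF g]
  have "(\<integral>\<^sup>+x. ennreal (exp (- q * fst x)) * masked N (indicator B) x \<partial>(lborel \<Otimes>\<^sub>M Pr z)) = 0"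
    using resolvent_eq_masked[OF z N g meas[rule_format, OF g]] B(2) by simp
  then have "AE x in lborel \<Otimes>\<^sub>M Pr z. ennreal (exp (- q * fst x)) * masked N (indicator B) x = 0"
    by (subst (asm) nn_integral_0_iff_AE) measurable
  with AE_space show ?thesis
  proof eventually_elim
    case (elim x)
    then have "masked N (indicator B) x = 0" "snd x \<in> space M"
      by (auto simp: space_pair_measure space_Pr[OF z])
    then show ?case
      using B(3) state_space[of "fst x" "snd x"] by (force simp: masked_def case_prod_beta)
  qed
qed

section \<open>The jump estimate\<close>

text \<open>After exchanging the integrals, the Markov property is applied at each fixed time
  \<open>t\<close> with the event that the state is in \<open>U\<close>. It replaces
  \<open>u\<close> of the state at time \<open>t + h\<close> by the \<open>Q h\<close> integral of
  \<open>u\<close> at the state at time \<open>t\<close>.\<close>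

lemma nn_integral_jump_eq_resolvent:
  assumes z: "z \<in> S" and N: "N \<in> null_sets (Pr z)" and h: "0 \<le> h"
    and meas: "\<forall>g\<in>borel_measurable (borel_on S). masked N g \<in> borel_measurable (lborel \<Otimes>\<^sub>M Pr z)"
    and U: "U \<in> sets (borel_on S)" and u: "u \<in> borel_measurable (borel_on S)"
  shows "(\<integral>\<^sup>+\<omega>. (\<integral>\<^sup>+t. ennreal (exp (- \<alpha> * t)) * (masked N (indicator U) (t, \<omega>) * masked N u (t + h, \<omega>)) \<partial>lborel) \<partial>Pr z) =
         resolvent Q \<alpha> (\<lambda>y. indicator U y * (\<integral>\<^sup>+w. u w \<partial>Q h y)) z"
proof -
  interpret law: prob_space "Pr z"
    by (rule prob_space_Pr) fact
  interpret pair_sigma_finite "lborel :: real measure" "Pr z" ..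
  have [measurable_cong]: "sets (Pr z) = sets M"
    by (rule sets_Pr) fact
  let ?L = "(lborel :: real measure) \<Otimes>\<^sub>M Pr z"
  let ?g = "\<lambda>y. indicator U y * (\<integral>\<^sup>+w. u w \<partial>Q h y) :: ennreal"
  have [measurable]: "indicator U \<in> borel_measurable (borel_on S)"
    using U by simp
  have g: "?g \<in> borel_measurable (borel_on S)"
    using kernel_measurable[OF h u] by simp
  note [measurable] = meas[rule_format, OF g] meas[rule_format, OF u] meas[rule_format, OF \<open>indicator U \<in> _\<close>]
  have [measurable]: "(\<lambda>x. masked N u (fst x + h, snd x)) \<in> borel_measurable ?L"
    by (rule measurable_compose[OF _ meas[rule_format, OF u]]) measurable
  have inner: "(\<integral>\<^sup>+\<omega>. masked N (indicator U) (t, \<omega>) * masked N u (t + h, \<omega>) \<partial>Pr z) = (\<integral>\<^sup>+\<omega>. masked N ?g (t, \<omega>) \<partial>Pr z)"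
    if t: "0 \<le> t" for t
  proof -
    let ?A = "{\<omega> \<in> space M. \<exists>y\<in>U. Z t \<omega> = Some y}"
    have "(\<integral>\<^sup>+\<omega>. masked N (indicator U) (t, \<omega>) * masked N u (t + h, \<omega>) \<partial>Pr z) =
        (\<integral>\<^sup>+\<omega>\<in>?A. at_state u (Z (t + h) \<omega>) \<partial>Pr z)"
      using AE_not_in[OF N] AE_space
      by (intro nn_integral_cong_AE, eventually_elim)
        (use t h in \<open>auto simp: masked_def indicator_def space_Pr[OF z] split: option.splits\<close>)
    also have "\<dots> = (\<integral>\<^sup>+\<omega>\<in>?A. at_state (\<lambda>y. \<integral>\<^sup>+w. u w \<partial>Q h y) (Z t \<omega>) \<partial>Pr z)"
      by (rule nn_integral_markov[OF z h t adapted[OF t U] u])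
    also have "\<dots> = (\<integral>\<^sup>+\<omega>. masked N ?g (t, \<omega>) \<partial>Pr z)"
      using AE_not_in[OF N] AE_space
      by (intro nn_integral_cong_AE, eventually_elim)
        (use t h in \<open>auto simp: masked_def indicator_def space_Pr[OF z] split: option.splits\<close>)
    finally show ?thesis .
  qed
  have "(\<integral>\<^sup>+\<omega>. (\<integral>\<^sup>+t. ennreal (exp (- \<alpha> * t)) * (masked N (indicator U) (t, \<omega>) * masked N u (t + h, \<omega>)) \<partial>lborel) \<partial>Pr z) =
      (\<integral>\<^sup>+t. (\<integral>\<^sup>+\<omega>. ennreal (exp (- \<alpha> * t)) * (masked N (indicator U) (t, \<omega>) * masked N u (t + h, \<omega>)) \<partial>Pr z) \<partial>lborel)"
    by (rule Fubini') (simp add: case_prod_beta)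
  also have "\<dots> = (\<integral>\<^sup>+t. (\<integral>\<^sup>+\<omega>. ennreal (exp (- \<alpha> * t)) * masked N ?g (t, \<omega>) \<partial>Pr z) \<partial>lborel)"
  proof (rule nn_integral_cong)
    fix t :: real
    have [measurable]: "(\<lambda>\<omega>. masked N (indicator U) (t, \<omega>) * masked N u (t + h, \<omega>)) \<in> borel_measurable (Pr z)"
      "(\<lambda>\<omega>. masked N ?g (t, \<omega>)) \<in> borel_measurable (Pr z)"
      by measurable
    show "(\<integral>\<^sup>+\<omega>. ennreal (exp (- \<alpha> * t)) * (masked N (indicator U) (t, \<omega>) * masked N u (t + h, \<omega>)) \<partial>Pr z) =
        (\<integral>\<^sup>+\<omega>. ennreal (exp (- \<alpha> * t)) * masked N ?g (t, \<omega>) \<partial>Pr z)"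
    proof (cases "0 \<le> t")
      case True
      then show ?thesis
        using inner[OF True] by (simp add: nn_integral_cmult)
    qed (simp add: masked_def)
  qed
  also have "\<dots> = (\<integral>\<^sup>+x. ennreal (exp (- \<alpha> * fst x)) * masked N ?g x \<partial>?L)"
    by (rule trans[OF _ law.nn_integral_fst]) simp_all
  also have "\<dots> = resolvent Q \<alpha> ?g z"
    by (rule resolvent_eq_masked[OF z N g meas[rule_format, OF g]])
  finally show ?thesis .
qed

text \<open>
  A jump from \<open>U\<close> into \<open>{u \<ge> c}\<close> at time \<open>t\<^sub>0\<close> is seen by
  \<open>1\<^sub>U(Z\<^sub>t) u(Z\<^sub>t\<^sub>+\<^sub>h)\<close> during the whole time interval \<open>(t\<^sub>0 - h, t\<^sub>0)\<close>, of length \<open>h\<close>, while the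
  expectation of the time integral of this quantity is \<open>o(h)\<close>.
\<close>

lemma AE_no_jump:
  assumes metr: "metrizable_space (euclidean :: 's topology)" and z: "z \<in> S" and \<alpha>: "0 \<le> \<alpha>"
    and U: "U \<in> sets (borel_on S)" and u: "u \<in> borel_measurable (borel_on S)"
    and V: "V \<in> borel_measurable (borel_on S)" "resolvent Q \<alpha> V z < \<infinity>"
    and dom: "\<And>h. 0 < h \<Longrightarrow> ae_for S Q (\<lambda>y. y \<in> U \<longrightarrow> ennreal (1 / h) * (\<integral>\<^sup>+w. u w \<partial>Q h y) \<le> V y)"
    and lim: "ae_for S Q (\<lambda>y. y \<in> U \<longrightarrow> ((\<lambda>h. ennreal (1 / h) * (\<integral>\<^sup>+w. u w \<partial>Q h y)) \<longlongrightarrow> 0) (at_right 0))"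
  shows "AE \<omega> in Pr z. \<forall>t\<^sub>0 c \<delta>. 0 < t\<^sub>0 \<and> 0 < c \<and> 0 < \<delta> \<longrightarrow>
      \<not> ((\<forall>r\<in>{0..<t\<^sub>0} \<inter> {t\<^sub>0 - \<delta><..}. \<exists>y\<in>U. Z r \<omega> = Some y) \<and> (\<forall>r\<in>{t\<^sub>0..<t\<^sub>0 + \<delta>}. c \<le> at_state u (Z r \<omega>)))"
proof -
  interpret law: prob_space "Pr z"
    by (rule prob_space_Pr) fact
  interpret pair_sigma_finite "lborel :: real measure" "Pr z" ..
  let ?L = "(lborel :: real measure) \<Otimes>\<^sub>M Pr z"
  obtain N where N: "N \<in> null_sets (Pr z)"
    and meas: "\<forall>g\<in>borel_measurable (borel_on S). masked N g \<in> borel_measurable ?L"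
    using masked_measurable_exists[OF metr z] by blast
  \<comment> \<open>Fatou and dominated convergence are used along a sequence. The domination may
    then have a different exceptional set for each \<open>m\<close>.\<close>
  define h where "h m = 1 / real (Suc m)" for m
  have h: "0 < h m" for m
    by (simp add: h_def)
  have h_lim: "filterlim h (at_right 0) sequentially"
  proof (rule tendsto_imp_filterlim_at_right)
    show "h \<longlonglongrightarrow> 0"
      using LIMSEQ_inverse_real_of_nat unfolding h_def inverse_eq_divide .
  qed (use h in auto)
  define g where "g m y = indicator U y * (\<integral>\<^sup>+w. u w \<partial>Q (h m) y)" for m y
  have g: "g m \<in> borel_measurable (borel_on S)" for m
    unfolding g_def using U kernel_measurable[OF less_imp_le[OF h] u] by simp
  have [measurable]: "indicator U \<in> borel_measurable (borel_on S)"
    using U by simp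
  note [measurable] = meas[rule_format, OF g] meas[rule_format, OF u] meas[rule_format, OF V(1)] meas[rule_format, OF \<open>indicator U \<in> _\<close>]
  have [measurable]: "(\<lambda>x. masked N u (fst x + a, snd x)) \<in> borel_measurable ?L" for a
    by (rule measurable_compose[OF _ meas[rule_format, OF u]]) measurable
  \<comment> \<open>\<open>K m\<close> is the pathwise jump functional divided by the time step. Its
    expectation is computed in \<open>K_eq\<close> as an integral over time and paths, where
    dominated convergence applies with \<open>V\<close> as majorant.\<close>
  define K where "K m \<omega> = ennreal (1 / h m) *
      (\<integral>\<^sup>+t. ennreal (exp (- \<alpha> * t)) * (masked N (indicator U) (t, \<omega>) * masked N u (t + h m, \<omega>)) \<partial>lborel)" for m \<omega>
  have K_meas': "(\<lambda>\<omega>. \<integral>\<^sup>+t. ennreal (exp (- \<alpha> * t)) * (masked N (indicator U) (t, \<omega>) * masked N u (t + h m, \<omega>)) \<partial>lborel)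
      \<in> borel_measurable (Pr z)" for m
    by (rule lborel.borel_measurable_nn_integral) measurable
  then have K_meas[measurable]: "K m \<in> borel_measurable (Pr z)" for m
    unfolding K_def by measurable
  have K_eq: "(\<integral>\<^sup>+\<omega>. K m \<omega> \<partial>Pr z) =
      (\<integral>\<^sup>+x. ennreal (1 / h m) * (ennreal (exp (- \<alpha> * fst x)) * masked N (g m) x) \<partial>?L)" for m
    using nn_integral_jump_eq_resolvent[OF z N less_imp_le[OF h] meas U u, of \<alpha>]
      resolvent_eq_masked[OF z N g meas[rule_format, OF g], of \<alpha>]
    by (simp add: K_def nn_integral_cmult K_meas' g_def[symmetric])
  have "(\<lambda>m. \<integral>\<^sup>+x. ennreal (1 / h m) * (ennreal (exp (- \<alpha> * fst x)) * masked N (g m) x) \<partial>?L) \<longlonglongrightarrow>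
      (\<integral>\<^sup>+x. 0 \<partial>?L)"
  proof (rule nn_integral_dominated_convergence[where w = "\<lambda>x. ennreal (exp (- \<alpha> * fst x)) * masked N V x"])
    fix m
    show "AE x in ?L. ennreal (1 / h m) * (ennreal (exp (- \<alpha> * fst x)) * masked N (g m) x) \<le>
        ennreal (exp (- \<alpha> * fst x)) * masked N V x"
      using AE_masked[OF z N meas dom[OF h[of m]]]
    proof eventually_elim
      case (elim x)
      then have "ennreal (1 / h m) * masked N (g m) x \<le> masked N V x"
        by (auto simp: masked_def g_def case_prod_beta indicator_def split: option.splits)
      from mult_left_mono[OF this, of "ennreal (exp (- \<alpha> * fst x))"] show ?case
        by (simp add: ac_simps)
    qed
  next
    show "AE x in ?L. (\<lambda>m. ennreal (1 / h m) * (ennreal (exp (- \<alpha> * fst x)) * masked N (g m) x)) \<longlonglongrightarrow> 0"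
      using AE_masked[OF z N meas lim]
    proof eventually_elim
      case (elim x)
      have "(\<lambda>m. ennreal (1 / h m) * masked N (g m) x) \<longlonglongrightarrow> 0"
      proof (cases "0 \<le> fst x \<and> snd x \<notin> N \<and> (\<exists>y\<in>U. Z (fst x) (snd x) = Some y)")
        case True
        then obtain y where y: "0 \<le> fst x" "snd x \<notin> N" "y \<in> U" "Z (fst x) (snd x) = Some y"
          by blast
        with elim have "((\<lambda>h. ennreal (1 / h) * (\<integral>\<^sup>+w. u w \<partial>Q h y)) \<longlongrightarrow> 0) (at_right 0)"
          by blast
        from filterlim_compose[OF this h_lim] show ?thesis
          using y by (simp add: masked_def g_def case_prod_beta)
      next
        case False
        then have "masked N (g m) x = 0" for m
          by (auto simp: masked_def g_def case_prod_beta indicator_def split: option.splits)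
        then show ?thesis
          by simp
      qed
      from ennreal_tendsto_cmult[OF _ this, of "ennreal (exp (- \<alpha> * fst x))"] show ?case
        by (simp add: ac_simps)
    qed
  next
    show "(\<integral>\<^sup>+x. ennreal (exp (- \<alpha> * fst x)) * masked N V x \<partial>?L) < \<infinity>"
      using resolvent_eq_masked[OF z N V(1) meas[rule_format, OF V(1)], of \<alpha>] V(2) by simp
  qed measurable
  then have "(\<lambda>m. \<integral>\<^sup>+\<omega>. K m \<omega> \<partial>Pr z) \<longlonglongrightarrow> 0"
    by (simp add: K_eq)
  then have "liminf (\<lambda>m. \<integral>\<^sup>+\<omega>. K m \<omega> \<partial>Pr z) = 0"
    by (intro lim_imp_Liminf) simp_all
  \<comment> \<open>Fatou: the expectation of the lower limit is at most the lower limit of the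
    expectations, which is 0. The exceptional set obtained from this is independent of
    \<open>t\<^sub>0\<close>, \<open>c\<close> and \<open>\<delta>\<close>, so all jumps are
    excluded at once.\<close>
  then have "(\<integral>\<^sup>+\<omega>. liminf (\<lambda>m. K m \<omega>) \<partial>Pr z) = 0"
    using nn_integral_liminf[of K "Pr z", OF K_meas] by simp
  moreover have "(\<lambda>\<omega>. liminf (\<lambda>m. K m \<omega>)) \<in> borel_measurable (Pr z)"
    by (intro borel_measurable_liminf K_meas)
  ultimately have "AE \<omega> in Pr z. liminf (\<lambda>m. K m \<omega>) = 0"
    by (simp add: nn_integral_0_iff_AE)
  then show ?thesis
    using AE_not_in[OF N]
  proof eventually_elim
    case (elim \<omega>)
    show ?case
    proof (intro allI impI notI, elim conjE)
      fix t\<^sub>0 \<delta> :: real and c :: ennreal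
      assume pos: "0 < t\<^sub>0" "0 < c" "0 < \<delta>"
        and left: "\<forall>r\<in>{0..<t\<^sub>0} \<inter> {t\<^sub>0 - \<delta><..}. \<exists>y\<in>U. Z r \<omega> = Some y"
        and right: "\<forall>r\<in>{t\<^sub>0..<t\<^sub>0 + \<delta>}. c \<le> at_state u (Z r \<omega>)"
      \<comment> \<open>A step below \<delta> keeps \<open>t\<close> and \<open>t + h m\<close> in
        the two windows around the jump; a step below \<open>t\<^sub>0\<close> keeps
        \<open>t\<close> positive.\<close>
      have "\<forall>\<^sub>F a in at_right 0. a \<in> {0<..<min \<delta> t\<^sub>0}"
        by (rule eventually_at_right_real) (use pos in simp)
      from eventually_compose_filterlim[OF this h_lim]
      have "\<forall>\<^sub>F m in sequentially. ennreal (exp (- \<alpha> * t\<^sub>0)) * c \<le> K m \<omega>"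
      proof eventually_elim
        case (elim m)
        \<comment> \<open>For \<open>t\<close> in the interval of length \<open>h m\<close> before
          the jump, \<open>t\<close> sees \<open>U\<close> and \<open>t + h m\<close> sees the
          values at least \<open>c\<close>. Since \<alpha> is nonnegative, the weight there is at
          least its value at \<open>t\<^sub>0\<close>.\<close>
        have "ennreal (exp (- \<alpha> * t\<^sub>0)) * c * indicator {t\<^sub>0 - h m<..<t\<^sub>0} t \<le>
            ennreal (exp (- \<alpha> * t)) * (masked N (indicator U) (t, \<omega>) * masked N u (t + h m, \<omega>))" for t
        proof (cases "t \<in> {t\<^sub>0 - h m<..<t\<^sub>0}")
          case True
          then obtain y where "y \<in> U" "Z t \<omega> = Some y"
            using left[rule_format, of t] elim by auto
          then have "masked N (indicator U) (t, \<omega>) = 1"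
            using True elim \<open>\<omega> \<notin> N\<close> by (simp add: masked_def)
          moreover have "c \<le> masked N u (t + h m, \<omega>)"
            using right[rule_format, of "t + h m"] True elim \<open>\<omega> \<notin> N\<close> by (simp add: masked_def)
          moreover have "exp (- \<alpha> * t\<^sub>0) \<le> exp (- \<alpha> * t)"
            using True \<alpha> by (simp add: mult_left_mono)
          ultimately show ?thesis
            using True by (auto intro!: mult_mono ennreal_leI)
        qed simp
        then have "(\<integral>\<^sup>+t. ennreal (exp (- \<alpha> * t\<^sub>0)) * c * indicator {t\<^sub>0 - h m<..<t\<^sub>0} t \<partial>lborel) \<le>
            (\<integral>\<^sup>+t. ennreal (exp (- \<alpha> * t)) * (masked N (indicator U) (t, \<omega>) * masked N u (t + h m, \<omega>)) \<partial>lborel)"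
          by (intro nn_integral_mono)
        \<comment> \<open>The length of the interval cancels the factor \<open>1 / h m\<close>,
          leaving a positive lower bound independent of \<open>m\<close>.\<close>
        then have "ennreal (1 / h m) * (ennreal (exp (- \<alpha> * t\<^sub>0)) * c * ennreal (h m)) \<le> K m \<omega>"
          unfolding K_def using h[of m] by (intro mult_left_mono) (simp_all add: nn_integral_cmult_indicator)
        moreover have "ennreal (1 / h m) * (ennreal (exp (- \<alpha> * t\<^sub>0)) * c * ennreal (h m)) =
            ennreal (exp (- \<alpha> * t\<^sub>0)) * c * (ennreal (1 / h m) * ennreal (h m))"
          by (simp only: ac_simps)
        moreover have "ennreal (1 / h m) * ennreal (h m) = 1"
          using h[of m] by (simp flip: ennreal_mult)
        ultimately show ?case
          by simp
      qed
      then have "ennreal (exp (- \<alpha> * t\<^sub>0)) * c \<le> liminf (\<lambda>m. K m \<omega>)"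
        by (rule Liminf_bounded)
      with \<open>liminf (\<lambda>m. K m \<omega>) = 0\<close> \<open>0 < c\<close> show False
        by simp
    qed
  qed
qed

text \<open>The two negligible sets may come with different values of \<open>q\<close>. Passing to
  time-path pairs removes this dependence: both sets are missed by almost every pair, so the
  resolvent of the union vanishes at the \<open>q\<close> of the first set.\<close>

lemma ae_for_conj:
  assumes metr: "metrizable_space (euclidean :: 's topology)"
    and R: "ae_for S Q R" "ae_for S Q R'"
  shows "ae_for S Q (\<lambda>z. R z \<and> R' z)"
proof -
  obtain A q where A: "A \<in> sets (borel_on S)" "0 < q" "\<forall>z\<in>S. resolvent Q q (indicator A) z = 0" "\<forall>z\<in>S - A. R z"
    using R(1) unfolding ae_for_def negligible_for_def by blast
  obtain B where B: "negligible_for S Q B" "\<forall>z\<in>S - B. R' z"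
    using R(2) unfolding ae_for_def by blast
  have ae_A: "ae_for S Q (\<lambda>z. z \<notin> A)" and ae_B: "ae_for S Q (\<lambda>z. z \<notin> B)"
    using A B unfolding ae_for_def negligible_for_def by blast+
  have AB: "A \<union> B \<in> sets (borel_on S)"
    using A B unfolding negligible_for_def by blast
  then have ind: "indicator (A \<union> B) \<in> borel_measurable (borel_on S)"
    by simp
  have "resolvent Q q (indicator (A \<union> B)) z = 0" if z: "z \<in> S" for z
  proof -
    obtain N where N: "N \<in> null_sets (Pr z)"
      and meas: "\<forall>g\<in>borel_measurable (borel_on S). masked N g \<in> borel_measurable (lborel \<Otimes>\<^sub>M Pr z)"
      using masked_measurable_exists[OF metr z] by blast
    have "AE x in lborel \<Otimes>\<^sub>M Pr z. ennreal (exp (- q * fst x)) * masked N (indicator (A \<union> B)) x = 0"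
      using AE_masked[OF z N meas ae_A] AE_masked[OF z N meas ae_B]
      by eventually_elim (auto simp: masked_def case_prod_beta indicator_def split: option.splits)
    then have "(\<integral>\<^sup>+x. ennreal (exp (- q * fst x)) * masked N (indicator (A \<union> B)) x \<partial>(lborel \<Otimes>\<^sub>M Pr z)) =
        (\<integral>\<^sup>+x. 0 \<partial>((lborel :: real measure) \<Otimes>\<^sub>M Pr z))"
      by (rule nn_integral_cong_AE)
    then show ?thesis
      using resolvent_eq_masked[OF z N ind meas[rule_format, OF ind], of q] by simp
  qed
  then have "negligible_for S Q (A \<union> B)"
    using AB A(2) unfolding negligible_for_def by blast
  then show ?thesis
    using A(4) B(2) unfolding ae_for_def by blast
qed

end

lemma open_Int_sets_borel_on: "open W \<Longrightarrow> W \<inter> S \<in> sets (borel_on S)"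
  by (metis Int_commute borel_open image_eqI sets_restrict_space)

lemma ae_for_mono:
  assumes "ae_for S Q R" and "\<And>z. z \<in> S \<Longrightarrow> R z \<Longrightarrow> R' z"
  shows "ae_for S Q R'"
  using assms unfolding ae_for_def by blast

section \<open>Time intervals inside an excursion\<close>

lemma hitting_time_nonneg: "0 \<le> hitting_time Z A \<omega>"
  unfolding hitting_time_def by (rule Inf_greatest) (auto simp: zero_ereal_def)

lemma hitting_time_after_nonneg: "0 \<le> R \<omega> \<Longrightarrow> 0 \<le> hitting_time_after Z \<theta> A R \<omega>"
  unfolding hitting_time_after_def by (simp add: hitting_time_nonneg)

lemma entrance_time_nonneg: "0 \<le> entrance_time Z \<theta> A B k \<omega>"
  by (induction k) (simp_all add: hitting_time_nonneg hitting_time_after_nonneg)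

lemma alive_before_lifetime: "0 \<le> t \<Longrightarrow> ereal t < lifetime Z \<omega> \<Longrightarrow> Z t \<omega> \<noteq> None"
  unfolding lifetime_def by (metis (mono_tags, lifting) Inf_lower leD mem_Collect_eq)

context markov_process
begin

text \<open>With \<open>a\<close> the entrance time, a visit to the complement of \<open>G\<close>
  at some \<open>r > a\<close> would be a hit of the shifted path at the positive time
  \<open>r - a\<close>, forcing the exit time to be at most \<open>r\<close>.\<close>

lemma excursion_set_interval:
  assumes \<omega>: "\<omega> \<in> space M" and t: "t \<in> excursion_set S Z \<theta> G Gn \<omega>"
  obtains a b where "0 \<le> a" "a < t" "t < b"
    and "\<And>r y. a < r \<Longrightarrow> r < b \<Longrightarrow> Z r \<omega> = Some y \<Longrightarrow> y \<in> G"
proof -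
  obtain n k where lo: "entrance_time Z \<theta> (Gn n) (S - G) k \<omega> < ereal t"
    and hi: "ereal t < exit_time Z \<theta> (Gn n) (S - G) k \<omega>"
    using t unfolding excursion_set_def by blast
  have "0 \<le> entrance_time Z \<theta> (Gn n) (S - G) k \<omega>"
    by (rule entrance_time_nonneg)
  with lo obtain a where a: "entrance_time Z \<theta> (Gn n) (S - G) k \<omega> = ereal a" "0 \<le> a" "a < t"
    by (cases "entrance_time Z \<theta> (Gn n) (S - G) k \<omega>") auto
  \<comment> \<open>The exit time may be infinite, so a real bound strictly below it is
    chosen.\<close>
  obtain b where b: "t < b" "ereal b < exit_time Z \<theta> (Gn n) (S - G) k \<omega>"
    using ereal_dense2[OF hi] by auto
  show ?thesis
  proof (rule that[OF a(2,3) b(1)], rule ccontr)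
    fix r y assume r: "a < r" "r < b" "Z r \<omega> = Some y" "y \<notin> G"
    have "Z (r - a) (\<theta> a \<omega>) = Some y"
      using shift[of "r - a" a \<omega>] r a \<omega> by simp
    moreover have "y \<in> S"
      using state_space[of r \<omega> y] r a \<omega> by simp
    ultimately have "hitting_time Z (S - G) (\<theta> a \<omega>) \<le> ereal (r - a)"
      unfolding hitting_time_def using r by (intro Inf_lower) auto
    then have "ereal a + hitting_time Z (S - G) (\<theta> a \<omega>) \<le> ereal a + ereal (r - a)"
      by (rule add_left_mono)
    then have "exit_time Z \<theta> (Gn n) (S - G) k \<omega> \<le> ereal r"
      by (simp add: exit_time_def hitting_time_after_def a)
    with b(2) have "ereal b < ereal r"
      by (rule less_le_trans)
    with r(2) show False
      by simp
  qed
qed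

end

section \<open>The space-time kernel and its deterministic clock\<close>

lemma nonhom_kernel_sets:
  assumes "nonhom_transition_function P" "0 \<le> s" "s \<le> t"
  shows "sets (P s t x) = sets borel" "subprob_space (P s t x)"
proof -
  have "P s t \<in> borel \<rightarrow>\<^sub>M subprob_algebra borel"
    using assms unfolding nonhom_transition_function_def by blast
  then have "P s t x \<in> space (subprob_algebra borel)"
    by (rule measurable_space) simp
  then show "sets (P s t x) = sets borel" "subprob_space (P s t x)"
    by (simp_all add: space_subprob_algebra)
qed

lemma spacetime_embedding_measurable:
  fixes P :: "real \<Rightarrow> real \<Rightarrow> 'e::topological_space \<Rightarrow> 'e measure"
  assumes P: "nonhom_transition_function P" and "0 \<le> s" "0 \<le> t"
  shows "(\<lambda>y. (y, s + t)) \<in> P s (s + t) x \<rightarrow>\<^sub>M borel_on space_time"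
proof -
  have "(\<lambda>y. (y, s + t)) \<in> (borel :: 'e measure) \<rightarrow>\<^sub>M borel_on space_time"
    by (rule measurable_restrict_space2)
      (use assms in \<open>auto simp: space_time_def intro!: borel_measurable_continuous_onI continuous_intros\<close>)
  then show ?thesis
    using nonhom_kernel_sets(1)[OF P, of s "s + t" x] assms by (simp cong: measurable_cong_sets)
qed

lemma nn_integral_spacetime_kernel:
  assumes "nonhom_transition_function P" "0 \<le> s" "0 \<le> t" "g \<in> borel_measurable (borel_on space_time)"
  shows "(\<integral>\<^sup>+w. g w \<partial>spacetime_kernel P t (x, s)) = (\<integral>\<^sup>+y. g (y, s + t) \<partial>P s (s + t) x)"
  unfolding spacetime_kernel_def
  using assms(4) by (simp add: nn_integral_distr[OF spacetime_embedding_measurable[OF assms(1-3)]])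

lemma integral_spacetime_kernel:
  fixes g :: "'e::topological_space \<times> real \<Rightarrow> real"
  assumes "nonhom_transition_function P" "0 \<le> s" "0 \<le> t" "g \<in> borel_measurable (borel_on space_time)"
  shows "(\<integral>w. g w \<partial>spacetime_kernel P t (x, s)) = (\<integral>y. g (y, s + t) \<partial>P s (s + t) x)"
  unfolding spacetime_kernel_def
  using integral_distr[OF spacetime_embedding_measurable[OF assms(1-3)] assms(4)] by simp

lemma open_snd_dist: "open {y :: 'e::topological_space \<times> real. \<bar>snd y - c\<bar> < e}"
  by (intro open_Collect_less continuous_intros)

text \<open>At a fixed time the kernel charges only states with time coordinate
  \<open>s + t\<close>. Countability gives this at all nonnegative rational times simultaneously,
  and right continuity carries it to all times.\<close>

lemma AE_spacetime_clock:
  fixes P :: "real \<Rightarrow> real \<Rightarrow> 'e::topological_space \<Rightarrow> 'e measure"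
  assumes P: "nonhom_transition_function P"
    and Z: "right_process space_time (spacetime_kernel P) M Ft Z \<theta> Pr"
    and s: "0 \<le> s"
  shows "AE \<omega> in Pr (x, s). \<forall>t\<ge>0. \<forall>y. Z t \<omega> = Some y \<longrightarrow> snd y = s + t"
proof -
  interpret right_process space_time "spacetime_kernel P" M Ft Z \<theta> Pr
    by (fact Z)
  have z: "(x, s) \<in> space_time"
    using s by (simp add: space_time_def)
  have [measurable_cong]: "sets (Pr (x, s)) = sets M"
    by (rule sets_Pr[OF z])
  have fixed: "AE \<omega> in Pr (x, s). \<forall>y. Z t \<omega> = Some y \<longrightarrow> snd y = s + t" if t: "0 \<le> t" for t
  proof -
    let ?B = "{y \<in> space_time. snd y \<noteq> s + t}"
    have "?B = {y. snd y \<noteq> s + t} \<inter> space_time"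
      by auto
    also have "\<dots> \<in> sets (borel_on space_time)"
      by (intro open_Int_sets_borel_on open_Collect_neq continuous_intros)
    finally have B: "?B \<in> sets (borel_on space_time)" .
    then have g: "indicator ?B \<in> borel_measurable (borel_on space_time)"
      by (rule borel_measurable_indicator)
    have [measurable]: "(\<lambda>\<omega>. at_state (indicator ?B) (Z t \<omega>)) \<in> borel_measurable M"
      by (rule at_state_measurable[OF t g])
    have "(\<integral>\<^sup>+\<omega>. at_state (indicator ?B) (Z t \<omega>) \<partial>Pr (x, s)) = 0"
      using nn_integral_state[OF z t g] nn_integral_spacetime_kernel[OF P s t g, of x] by simp
    then have "AE \<omega> in Pr (x, s). at_state (indicator ?B) (Z t \<omega>) = 0"
      by (subst (asm) nn_integral_0_iff_AE) measurable
    with AE_space show ?thesis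
    proof eventually_elim
      case (elim \<omega>)
      then show ?case
        using state_space[OF t, of \<omega>] by (auto simp: space_Pr[OF z] indicator_def split: if_splits)
    qed
  qed
  then have "AE \<omega> in Pr (x, s). \<forall>q. 0 \<le> real_of_rat q \<longrightarrow> (\<forall>y. Z (of_rat q) \<omega> = Some y \<longrightarrow> snd y = s + of_rat q)"
    by (subst AE_all_countable) auto
  with right_continuous_paths[OF z] show ?thesis
  proof eventually_elim
    case (elim \<omega>)
    show ?case
    proof (intro allI impI, rule ccontr)
      fix t y assume t: "0 \<le> t" and y: "Z t \<omega> = Some y" and ne: "snd y \<noteq> s + t"
      \<comment> \<open>If the clock is off by \<open>e\<close> at time \<open>t\<close>, then at a
        rational time within \<open>e / 2\<close> after \<open>t\<close> the time coordinate would
        be within \<open>e / 2\<close> of both \<open>snd y\<close> and \<open>s + t\<close>, which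
        are \<open>e\<close> apart.\<close>
      define e where "e = \<bar>snd y - (s + t)\<bar>"
      have "0 < e"
        using ne by (simp add: e_def)
      have "path_tendsto (\<lambda>t. Z t \<omega>) y (at_right t)"
        using elim(1) t y unfolding right_continuous_from_def by blast
      then have "\<forall>\<^sub>F u in at_right t. \<exists>y'\<in>{y'. \<bar>snd y' - snd y\<bar> < e / 2}. Z u \<omega> = Some y'"
        unfolding path_tendsto_def using open_snd_dist[of "snd y" "e / 2"] \<open>0 < e\<close> by auto
      then obtain b where b: "t < b" "\<And>u. t < u \<Longrightarrow> u < b \<Longrightarrow> \<exists>y'\<in>{y'. \<bar>snd y' - snd y\<bar> < e / 2}. Z u \<omega> = Some y'"
        unfolding eventually_at_right_field by blast
      obtain q where q: "t < of_rat q" "of_rat q < min b (t + e / 2)"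
        using of_rat_dense[of t "min b (t + e / 2)"] b(1) \<open>0 < e\<close> by auto
      then obtain y' where y': "\<bar>snd y' - snd y\<bar> < e / 2" "Z (of_rat q) \<omega> = Some y'"
        using b(2)[of "of_rat q"] by auto
      have "snd y' = s + of_rat q"
        using elim(2) y'(2) less_imp_le[OF le_less_trans[OF t q(1)]] by blast
      with q have "\<bar>snd y' - (s + t)\<bar> < e / 2"
        by simp
      with y'(1) show False
        using dist_triangle_half_r[of "snd y'" "snd y" e "s + t"] by (simp add: dist_real_def e_def)
    qed
  qed
qed

section \<open>Continuity of a single path\<close>

text \<open>A pathwise argument: right continuity is given, so the left limit must be identified
  with the present state. Levels in \<open>no_jump\<close> are rational so that only countably many
  almost sure statements have to hold together.\<close>

lemma continuous_at_if_no_jump: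
  fixes p :: "real \<Rightarrow> ('e::topological_space \<times> real) option"
  assumes rc: "right_continuous_from 0 p" and ll: "left_limits_from space_time 0 p"
    and clock: "\<And>t y. 0 \<le> t \<Longrightarrow> p t = Some y \<Longrightarrow> snd y = s + t"
    and interval: "0 \<le> a" "a < t" "t < b" "\<And>r y. a < r \<Longrightarrow> r < b \<Longrightarrow> p r = Some y \<Longrightarrow> y \<in> G \<times> {0..}"
    and y: "p t = Some y"
    and f: "\<And>n. continuous_on UNIV (f n)" "\<And>n x. 0 \<le> f n x"
    and \<phi>: "\<And>k. continuous_on UNIV (\<phi> k)" "\<And>r. (\<lambda>k. \<phi> k r) \<longlonglongrightarrow> max r 0"
    and separation: "\<And>x y. x \<in> closure G \<Longrightarrow> y \<in> G \<Longrightarrow> x \<noteq> y \<Longrightarrow> \<exists>n. f n x < (f n y :: real)"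
    and no_jump: "\<And>n k q t\<^sub>0 c \<delta>. 0 \<le> real_of_rat q \<Longrightarrow> 0 < t\<^sub>0 \<Longrightarrow> 0 < c \<Longrightarrow> 0 < \<delta> \<Longrightarrow>
      \<forall>r\<in>{0..<t\<^sub>0} \<inter> {t\<^sub>0 - \<delta><..}. \<exists>y\<in>({x. f n x < of_rat q} \<inter> G) \<times> {0..}. p r = Some y \<Longrightarrow>
      \<forall>r\<in>{t\<^sub>0..<t\<^sub>0 + \<delta>}. c \<le> at_state (\<lambda>(x, s). ennreal (\<phi> k (f n x - of_rat q))) (p r) \<Longrightarrow> False"
  shows "((\<lambda>r. the (p r)) \<longlongrightarrow> the (p t)) (at t)"
proof -
  have "0 < t"
    using interval by simp
  have right: "path_tendsto p y (at_right t)"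
    using rc y \<open>0 < t\<close> unfolding right_continuous_from_def by (meson less_imp_le)
  obtain z where left: "path_tendsto p z (at_left t)"
    using ll y \<open>0 < t\<close> unfolding left_limits_from_def by blast
  have in_G: "\<forall>\<^sub>F u in at_left t. \<forall>y. p u = Some y \<longrightarrow> y \<in> G \<times> {0..}"
    using interval unfolding eventually_at_left_field by (intro exI[of _ a]) auto
  have "z = y"
  proof (rule ccontr)
    assume "z \<noteq> y"
    \<comment> \<open>The clock forces the time coordinate of the left limit, so a jump must change
      the spatial coordinate.\<close>
    have "snd z = s + t"
    proof (rule ccontr)
      assume ne: "snd z \<noteq> s + t"
      define e where "e = \<bar>snd z - (s + t)\<bar>"
      have "0 < e"
        using ne by (simp add: e_def)
      then have "\<forall>\<^sub>F u in at_left t. \<exists>y'\<in>{y'. \<bar>snd y' - snd z\<bar> < e / 2}. p u = Some y'"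
        using left open_snd_dist[of "snd z" "e / 2"] unfolding path_tendsto_def by auto
      moreover have "\<forall>\<^sub>F u in at_left t. max 0 (t - e / 2) < u \<and> u < t"
        unfolding eventually_at_left_field
        using \<open>0 < t\<close> \<open>0 < e\<close> by (intro exI[of _ "max 0 (t - e / 2)"]) auto
      ultimately have "\<forall>\<^sub>F u in at_left t. False"
      proof eventually_elim
        case (elim u)
        then obtain y' where y': "\<bar>snd y' - snd z\<bar> < e / 2" "p u = Some y'"
          by auto
        have "snd y' = s + u"
          using clock[OF _ y'(2)] elim(2) by simp
        with elim(2) have "\<bar>snd y' - (s + t)\<bar> < e / 2"
          by simp
        with y'(1) show False
          using dist_triangle_half_r[of "snd y'" "snd z" e "s + t"] by (simp add: dist_real_def e_def)
      qed
      then show False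
        by simp
    qed
    moreover have "snd y = s + t"
      using clock y \<open>0 < t\<close> by simp
    ultimately have ne: "fst z \<noteq> fst y"
      using \<open>z \<noteq> y\<close> by (simp add: prod_eq_iff)
    \<comment> \<open>The path is in \<open>G\<close> just before \<open>t\<close>, so its limit is
      in the closure; with \<open>fst y\<close> in \<open>G\<close> this is the situation in which
      \<open>separation\<close> applies.\<close>
    have "fst z \<in> closure G"
    proof (rule ccontr)
      assume "fst z \<notin> closure G"
      then have "\<forall>\<^sub>F u in at_left t. \<exists>y\<in>(- closure G) \<times> UNIV. p u = Some y"
        using left open_Times[OF open_Compl[OF closed_closure] open_UNIV, of G]
        unfolding path_tendsto_def by (auto simp: mem_Times_iff)
      with in_G have "\<forall>\<^sub>F u in at_left t. False"
        by eventually_elim (use closure_subset[of G] in auto)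
      then show False
        by simp
    qed
    moreover have "fst y \<in> G"
      using interval(4)[OF interval(2,3) y] by auto
    ultimately obtain n where n: "f n (fst z) < f n (fst y)"
      using separation ne by blast
    \<comment> \<open>The level lies strictly between the two values: the path is below it just
      before \<open>t\<close> and above it at \<open>t\<close>.\<close>
    obtain q where q: "f n (fst z) < of_rat q" "of_rat q < f n (fst y)"
      using of_rat_dense[OF n] by blast
    have "0 < max (f n (fst y) - of_rat q) 0"
      using q by simp
    then have "\<forall>\<^sub>F k in sequentially. 0 < \<phi> k (f n (fst y) - of_rat q)"
      by (rule order_tendstoD(1)[OF \<phi>(2)])
    then obtain k where k: "0 < \<phi> k (f n (fst y) - of_rat q)"
      by (auto simp: eventually_sequentially)
    \<comment> \<open>Half of the positive value at \<open>y\<close>, so that the strict bound by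
      \<open>c\<close> defines an open neighbourhood of \<open>y\<close> and persists just after
      \<open>t\<close>.\<close>
    define c where "c = \<phi> k (f n (fst y) - of_rat q) / 2"
    have "open ({x. f n x < of_rat q} \<times> (UNIV :: real set))"
      by (intro open_Times open_Collect_less f continuous_on_const open_UNIV)
    then have "\<forall>\<^sub>F u in at_left t. \<exists>y\<in>{x. f n x < of_rat q} \<times> UNIV. p u = Some y"
      using left q(1) unfolding path_tendsto_def by (auto simp: mem_Times_iff)
    with in_G have "\<forall>\<^sub>F u in at_left t. \<exists>y\<in>({x. f n x < of_rat q} \<inter> G) \<times> {0..}. p u = Some y"
      by eventually_elim fastforce
    then obtain t' where t': "t' < t" "\<And>u. t' < u \<Longrightarrow> u < t \<Longrightarrow> \<exists>y\<in>({x. f n x < of_rat q} \<inter> G) \<times> {0..}. p u = Some y"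
      unfolding eventually_at_left_field by blast
    have "continuous_on UNIV (\<lambda>y :: 'e \<times> real. \<phi> k (f n (fst y) - of_rat q))"
      by (auto intro!: continuous_on_compose2[OF \<phi>(1)[of k], where f = "\<lambda>y. f n (fst y) - of_rat q"]
          continuous_on_diff continuous_on_compose2[OF f(1)[of n], where f = fst] continuous_on_fst continuous_on_id continuous_on_const)
    then have "open {y :: 'e \<times> real. c < \<phi> k (f n (fst y) - of_rat q)}"
      by (intro open_Collect_less continuous_on_const)
    moreover have y_c: "y \<in> {y. c < \<phi> k (f n (fst y) - of_rat q)}"
      using k by (simp add: c_def)
    ultimately have "\<forall>\<^sub>F u in at_right t. \<exists>y\<in>{y. c < \<phi> k (f n (fst y) - of_rat q)}. p u = Some y"
      using right unfolding path_tendsto_def by blast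
    then obtain t'' where t'': "t < t''" "\<And>u. t < u \<Longrightarrow> u < t'' \<Longrightarrow> \<exists>y\<in>{y. c < \<phi> k (f n (fst y) - of_rat q)}. p u = Some y"
      unfolding eventually_at_right_field by blast
    show False
    proof (rule no_jump[of q t "ennreal c" "min (t - t') (t'' - t)" n k])
      \<comment> \<open>The level exceeds a value of the nonnegative function \<open>f n\<close>,
        hence it is among the levels allowed in the family.\<close>
      show "0 \<le> real_of_rat q"
        using f(2)[of n "fst z"] q(1) by linarith
      show "\<forall>r\<in>{0..<t} \<inter> {t - min (t - t') (t'' - t)<..}. \<exists>y\<in>({x. f n x < of_rat q} \<inter> G) \<times> {0..}. p r = Some y"
        using t'(2) by auto
      show "\<forall>r\<in>{t..<t + min (t - t') (t'' - t)}. ennreal c \<le> at_state (\<lambda>(x, s). ennreal (\<phi> k (f n x - of_rat q))) (p r)"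
      proof
        fix r assume r: "r \<in> {t..<t + min (t - t') (t'' - t)}"
        have "\<exists>y\<in>{y. c < \<phi> k (f n (fst y) - of_rat q)}. p r = Some y"
          using y y_c t''(2)[of r] r by (cases "r = t") auto
        then show "ennreal c \<le> at_state (\<lambda>(x, s). ennreal (\<phi> k (f n x - of_rat q))) (p r)"
          by (auto simp: case_prod_beta intro!: ennreal_leI)
      qed
    qed (use \<open>0 < t\<close> k t' t'' in \<open>auto simp: c_def\<close>)
  qed
  show ?thesis
  proof (rule topological_tendstoI)
    fix U assume "open U" "the (p t) \<in> U"
    then have "\<forall>\<^sub>F u in at_left t. \<exists>y\<in>U. p u = Some y" "\<forall>\<^sub>F u in at_right t. \<exists>y\<in>U. p u = Some y"
      using left right y unfolding path_tendsto_def \<open>z = y\<close> by auto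
    then have "\<forall>\<^sub>F u in at t. \<exists>y\<in>U. p u = Some y"
      by (simp add: eventually_at_split)
    then show "\<forall>\<^sub>F u in at t. the (p u) \<in> U"
      by eventually_elim auto
  qed
qed

section \<open>From the generator to the diffusion property\<close>

theorem corollary3p13:
  fixes P :: "real \<Rightarrow> real \<Rightarrow> 'e::topological_space \<Rightarrow> 'e measure"
    and MX :: "'v measure" and X :: "real \<Rightarrow> 'v \<Rightarrow> 'e option" and PrX :: "real \<Rightarrow> 'e \<Rightarrow> 'v measure"
    and M :: "'w measure" and Ft :: "real \<Rightarrow> 'w measure"
    and Z :: "real \<Rightarrow> 'w \<Rightarrow> ('e \<times> real) option" and \<theta> :: "real \<Rightarrow> 'w \<Rightarrow> 'w"
    and Pr :: "'e \<times> real \<Rightarrow> 'w measure"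
    and G :: "'e set" and f :: "nat \<Rightarrow> 'e \<Rightarrow> real" and \<phi> :: "nat \<Rightarrow> real \<Rightarrow> real"
    and \<alpha>\<^sub>0 :: real and \<C> :: "('e \<Rightarrow> real) set"
  assumes lusin: "lusin_space (euclidean :: 'e topology)"
    and X: "nonhom_cadlag_markov_process P MX X PrX"
    and Z: "cadlag_right_process space_time (spacetime_kernel P) M Ft Z \<theta> Pr"
    and G: "open G"
    and f: "\<And>n. continuous_on UNIV (f n) \<and> bounded (range (f n)) \<and> (\<forall>x. 0 \<le> f n x)"
    and \<phi>: "\<And>k. continuous_on UNIV (\<phi> k) \<and> (\<forall>r. 0 \<le> \<phi> k r)"
    and \<alpha>\<^sub>0: "0 < \<alpha>\<^sub>0"
    and separation: "\<And>x y. x \<in> closure G \<Longrightarrow> y \<in> G \<Longrightarrow> x \<noteq> y \<Longrightarrow> \<exists>n. f n x < f n y"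
    and \<phi>_increasing: "\<And>r. incseq (\<lambda>k. \<phi> k r) \<and> (\<lambda>k. \<phi> k r) \<longlonglongrightarrow> max r 0"
    and \<C>: "\<C> = {(\<lambda>x. \<phi> k (f n x - \<epsilon>)) | n k \<epsilon>. 0 \<le> \<epsilon>}"
    and domain: "\<And>u. u \<in> \<C> \<Longrightarrow> (\<lambda>(x, s). u x) \<in> parabolic_domain P \<alpha>\<^sub>0"
    and local: "\<And>u. u \<in> \<C> \<Longrightarrow>
      ae_for space_time (spacetime_kernel P)
        (\<lambda>(x, s). x \<in> interior {y. u y = 0} \<inter> G \<longrightarrow> gen_L P s u x = 0)"
  shows "diffusion_in space_time Z \<theta> Pr (G \<times> {0..})"
proof -
  interpret X: nonhom_cadlag_markov_process P MX X PrX
    by (fact X)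
  interpret cadlag_right_process space_time "spacetime_kernel P" M Ft Z \<theta> Pr
    by (fact Z)
  have P: "nonhom_transition_function P"
    by (fact X.transition_function)
  have metr: "metrizable_space (euclidean :: ('e \<times> real) topology)"
    using lusin_space_imp_metrizable[OF lusin] metrizable_space_euclidean
    by (simp add: metrizable_space_prod_topology flip: prod_topology_euclidean)
  define u where "u n k \<epsilon> x = \<phi> k (f n x - \<epsilon>)" for n k \<epsilon> x
  have u_cont: "continuous_on UNIV (u n k \<epsilon>)" for n k \<epsilon>
    unfolding u_def
    by (rule continuous_on_compose2[of UNIV "\<phi> k"]) (use \<phi> f in \<open>auto intro!: continuous_intros\<close>)
  have u_nonneg: "0 \<le> u n k \<epsilon> x" for n k \<epsilon> x
    using \<phi> by (simp add: u_def)
  have u_zero: "u n k \<epsilon> x = 0" if "f n x < \<epsilon>" for n k \<epsilon> x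
  proof -
    \<comment> \<open>An increasing sequence stays below its limit, the positive part, which is 0
      when \<open>f n x < \<epsilon>\<close>.\<close>
    have "\<phi> k (f n x - \<epsilon>) \<le> max (f n x - \<epsilon>) 0"
      using \<phi>_increasing[of "f n x - \<epsilon>"] by (intro incseq_le) auto
    with u_nonneg[of n k \<epsilon> x] that show ?thesis
      by (simp add: u_def)
  qed
  have no_jump: "AE \<omega> in Pr z. \<forall>t\<^sub>0 c \<delta>. 0 < t\<^sub>0 \<and> 0 < c \<and> 0 < \<delta> \<longrightarrow>
      \<not> ((\<forall>r\<in>{0..<t\<^sub>0} \<inter> {t\<^sub>0 - \<delta><..}. \<exists>y\<in>({x. f n x < \<epsilon>} \<inter> G) \<times> {0..}. Z r \<omega> = Some y) \<and>
         (\<forall>r\<in>{t\<^sub>0..<t\<^sub>0 + \<delta>}. c \<le> at_state (\<lambda>(x, s). ennreal (u n k \<epsilon> x)) (Z r \<omega>)))"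
    if z: "z \<in> space_time" and \<epsilon>: "0 \<le> \<epsilon>" for z n k \<epsilon>
  proof -
    have u_\<C>: "u n k \<epsilon> \<in> \<C>"
      unfolding \<C> u_def[abs_def] using \<epsilon> by blast
    let ?U = "({x. f n x < \<epsilon>} \<inter> G) \<times> {0..} :: ('e \<times> real) set"
    let ?g = "\<lambda>(x, s). ennreal (u n k \<epsilon> x) :: ennreal" and ?F = "\<lambda>(x, s). u n k \<epsilon> x"
    have open_f: "open {x. f n x < \<epsilon>}"
      using f by (intro open_Collect_less continuous_on_const) auto
    have F_cont: "continuous_on UNIV (?F :: 'e \<times> real \<Rightarrow> real)"
      unfolding case_prod_beta by (rule continuous_on_compose2[OF u_cont]) (auto intro!: continuous_intros)
    then have F: "(?F :: 'e \<times> real \<Rightarrow> real) \<in> borel_measurable (borel_on space_time)"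
      by (intro measurable_restrict_space1 borel_measurable_continuous_onI)
    then have g: "?g \<in> borel_measurable (borel_on space_time)"
      using measurable_compose[OF F measurable_ennreal] by (simp add: case_prod_beta)
    obtain B where B: "\<And>x. \<bar>u n k \<epsilon> x\<bar> \<le> B"
    proof -
      have "bounded (?F ` space_time)"
        using domain[OF u_\<C>] unfolding parabolic_domain_def by blast
      then obtain B where "\<forall>w\<in>?F ` space_time. norm w \<le> B"
        unfolding bounded_iff by blast
      then show thesis
        using that[of B] by (force simp: space_time_def)
    qed
    obtain V where V: "V \<in> borel_measurable (borel_on space_time)"
        "resolvent (spacetime_kernel P) \<alpha>\<^sub>0 V z < \<infinity>"
      and V_dom: "\<And>t. 0 < t \<Longrightarrow> ae_for space_time (spacetime_kernel P)
          (\<lambda>z. ennreal \<bar>((\<integral>w. ?F w \<partial>spacetime_kernel P t z) - ?F z) / t\<bar> \<le> V z)"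
      using domain[OF u_\<C>] z unfolding parabolic_domain_def by blast
    have limit: "ae_for space_time (spacetime_kernel P)
        (\<lambda>(x, s). \<exists>l. (diff_quotient P s (u n k \<epsilon>) x \<longlongrightarrow> l) (at_right 0))"
      using domain[OF u_\<C>] unfolding parabolic_domain_def by simp
    have kernel: "(\<integral>\<^sup>+w. ?g w \<partial>spacetime_kernel P h (x, s)) = ennreal (\<integral>y. u n k \<epsilon> y \<partial>P s (s + h) x)"
      if "0 \<le> s" "0 < h" for x s h
    proof -
      interpret K: subprob_space "P s (s + h) x"
        using nonhom_kernel_sets(2)[OF P] that by simp
      have "u n k \<epsilon> \<in> borel_measurable (P s (s + h) x)"
        using nonhom_kernel_sets(1)[OF P, of s "s + h" x] that borel_measurable_continuous_onI[OF u_cont]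
        by (simp cong: measurable_cong_sets)
      then have "integrable (P s (s + h) x) (u n k \<epsilon>)"
        using B by (intro K.integrable_const_bound[of _ B]) auto
      then show ?thesis
        using nn_integral_spacetime_kernel[OF P _ _ g, of s h x] that u_nonneg
        by (simp add: nn_integral_eq_integral)
    qed
    \<comment> \<open>On \<open>?U\<close> the function vanishes, so the difference quotient is the
      nonnegative quantity \<open>Q h u / h\<close> and can be treated as an extended nonnegative
      number.\<close>
    have quotient: "ennreal (1 / h) * (\<integral>\<^sup>+w. ?g w \<partial>spacetime_kernel P h (x, s)) =
        ennreal (diff_quotient P s (u n k \<epsilon>) x h)" if "(x, s) \<in> ?U" "0 < h" for x s h
      using that u_nonneg u_zero[of n x \<epsilon> k]
      by (simp add: kernel diff_quotient_def integral_nonneg flip: ennreal_mult)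
    show ?thesis
    proof (rule AE_no_jump[OF metr z less_imp_le[OF \<alpha>\<^sub>0] _ g V])
      have "?U = (({x. f n x < \<epsilon>} \<inter> G) \<times> UNIV) \<inter> space_time"
        by (auto simp: space_time_def)
      also have "\<dots> \<in> sets (borel_on space_time)"
        by (intro open_Int_sets_borel_on open_Times open_Int open_f G open_UNIV)
      finally show "?U \<in> sets (borel_on space_time)" .
    next
      fix h :: real assume h: "0 < h"
      show "ae_for space_time (spacetime_kernel P)
          (\<lambda>y. y \<in> ?U \<longrightarrow> ennreal (1 / h) * (\<integral>\<^sup>+w. ?g w \<partial>spacetime_kernel P h y) \<le> V y)"
      proof (rule ae_for_mono[OF V_dom[OF h]], intro impI)
        fix y assume le: "ennreal \<bar>((\<integral>w. ?F w \<partial>spacetime_kernel P h y) - ?F y) / h\<bar> \<le> V y" and U: "y \<in> ?U"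
        obtain x s where y: "y = (x, s)"
          by (cases y)
        with U have s: "0 \<le> s"
          by simp
        have "diff_quotient P s (u n k \<epsilon>) x h = ((\<integral>w. ?F w \<partial>spacetime_kernel P h y) - ?F y) / h"
          using integral_spacetime_kernel[OF P s less_imp_le[OF h] F, of x]
          by (simp add: y diff_quotient_def)
        then have "ennreal (diff_quotient P s (u n k \<epsilon>) x h) \<le> V y"
          using le by (metis abs_ge_self ennreal_leI order_trans)
        then show "ennreal (1 / h) * (\<integral>\<^sup>+w. ?g w \<partial>spacetime_kernel P h y) \<le> V y"
          using quotient[of x s h] U h by (simp add: y)
      qed
    next
      show "ae_for space_time (spacetime_kernel P)
          (\<lambda>y. y \<in> ?U \<longrightarrow> ((\<lambda>h. ennreal (1 / h) * (\<integral>\<^sup>+w. ?g w \<partial>spacetime_kernel P h y)) \<longlongrightarrow> 0) (at_right 0))"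
      \<comment> \<open>\<open>gen_L\<close> is a \<open>Lim\<close>, which says something about
        convergence only where a limit exists. Hence existence of the limit and its vanishing are
        combined almost everywhere.\<close>
      proof (rule ae_for_mono[OF ae_for_conj[OF metr limit local[OF u_\<C>]]], intro impI)
        fix y
        assume y: "(case y of (x, s) \<Rightarrow> \<exists>l. (diff_quotient P s (u n k \<epsilon>) x \<longlongrightarrow> l) (at_right 0)) \<and>
            (case y of (x, s) \<Rightarrow> x \<in> interior {y. u n k \<epsilon> y = 0} \<inter> G \<longrightarrow> gen_L P s (u n k \<epsilon>) x = 0)"
          and U: "y \<in> ?U"
        obtain x s where xs: "y = (x, s)"
          by (cases y)
        \<comment> \<open>The sublevel set is open and contained in the zero set, so it lies in the
          interior on which \<open>local\<close> gives a vanishing generator.\<close>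
        have "{x. f n x < \<epsilon>} \<subseteq> interior {y. u n k \<epsilon> y = 0}"
          by (rule interior_maximal[OF _ open_f]) (auto simp: u_zero)
        then have L: "gen_L P s (u n k \<epsilon>) x = 0"
          using y U xs by auto
        obtain l where l: "(diff_quotient P s (u n k \<epsilon>) x \<longlongrightarrow> l) (at_right 0)"
          using y xs by auto
        then have "l = 0"
          using L tendsto_Lim[OF _ l] by (simp add: gen_L_def)
        with l have "((\<lambda>h. ennreal (diff_quotient P s (u n k \<epsilon>) x h)) \<longlongrightarrow> 0) (at_right 0)"
          using tendsto_ennrealI by fastforce
        moreover have "\<forall>\<^sub>F h in at_right 0. ennreal (diff_quotient P s (u n k \<epsilon>) x h) =
            ennreal (1 / h) * (\<integral>\<^sup>+w. ?g w \<partial>spacetime_kernel P h y)"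
          using eventually_at_right_less[of "0 :: real"]
          by eventually_elim (use quotient U xs in simp)
        ultimately show "((\<lambda>h. ennreal (1 / h) * (\<integral>\<^sup>+w. ?g w \<partial>spacetime_kernel P h y)) \<longlongrightarrow> 0) (at_right 0)"
          by (rule Lim_transform_eventually)
      qed
    qed
  qed
  show ?thesis
    unfolding diffusion_in_def
  proof (intro allI impI ballI)
    fix Gn :: "nat \<Rightarrow> ('e \<times> real) set" and z :: "'e \<times> real"
    assume z: "z \<in> space_time"
    obtain x s where xs: "z = (x, s)" and s: "0 \<le> s"
      using z by (auto simp: space_time_def)
    \<comment> \<open>A countable intersection over \<open>n\<close>, \<open>k\<close> and rational
      levels gives one almost sure event for the whole path.\<close>
    have "AE \<omega> in Pr z. \<forall>n k q. 0 \<le> real_of_rat q \<longrightarrow> (\<forall>t\<^sub>0 c \<delta>. 0 < t\<^sub>0 \<and> 0 < c \<and> 0 < \<delta> \<longrightarrow>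
      \<not> ((\<forall>r\<in>{0..<t\<^sub>0} \<inter> {t\<^sub>0 - \<delta><..}. \<exists>y\<in>({x. f n x < of_rat q} \<inter> G) \<times> {0..}. Z r \<omega> = Some y) \<and>
         (\<forall>r\<in>{t\<^sub>0..<t\<^sub>0 + \<delta>}. c \<le> at_state (\<lambda>(x, s). ennreal (u n k (of_rat q) x)) (Z r \<omega>))))"
      unfolding AE_all_countable using no_jump[OF z] by simp
    then show "AE \<omega> in Pr z. continuous_on
        {t \<in> excursion_set space_time Z \<theta> (G \<times> {0..}) Gn \<omega>. 0 \<le> t \<and> ereal t < lifetime Z \<omega>}
        (\<lambda>t. the (Z t \<omega>))"
      using right_continuous_paths[OF z] left_limits[OF z]
        AE_spacetime_clock[OF P right_process_axioms s, of x, folded xs] AE_space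
    proof eventually_elim
      case (elim \<omega>)
      then have \<omega>: "\<omega> \<in> space M"
        by (simp add: space_Pr[OF z])
      show ?case
        unfolding continuous_on_def
      proof
        fix t assume t: "t \<in> {t \<in> excursion_set space_time Z \<theta> (G \<times> {0..}) Gn \<omega>. 0 \<le> t \<and> ereal t < lifetime Z \<omega>}"
        then obtain y where y: "Z t \<omega> = Some y"
          using alive_before_lifetime[of t Z \<omega>] by auto
        obtain a b where ab: "0 \<le> a" "a < t" "t < b"
          and G_ab: "\<And>r y. a < r \<Longrightarrow> r < b \<Longrightarrow> Z r \<omega> = Some y \<Longrightarrow> y \<in> G \<times> {0..}"
          using excursion_set_interval[OF \<omega>, of t] t by blast
        have "((\<lambda>t. the (Z t \<omega>)) \<longlongrightarrow> the (Z t \<omega>)) (at t)"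
        proof (rule continuous_at_if_no_jump[where p = "\<lambda>t. Z t \<omega>" and f = f and \<phi> = \<phi>, OF elim(2,3) _ ab G_ab y])
          fix n k q and t\<^sub>0 \<delta> :: real and c :: ennreal
          assume "0 \<le> real_of_rat q" "0 < t\<^sub>0" "0 < c" "0 < \<delta>"
            "\<forall>r\<in>{0..<t\<^sub>0} \<inter> {t\<^sub>0 - \<delta><..}. \<exists>y\<in>({x. f n x < of_rat q} \<inter> G) \<times> {0..}. Z r \<omega> = Some y"
            "\<forall>r\<in>{t\<^sub>0..<t\<^sub>0 + \<delta>}. c \<le> at_state (\<lambda>(x, s). ennreal (\<phi> k (f n x - of_rat q))) (Z r \<omega>)"
          then show False
            using elim(1) unfolding u_def by blast
        qed (use elim(4) f \<phi> \<phi>_increasing separation in auto)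
        then show "((\<lambda>t. the (Z t \<omega>)) \<longlongrightarrow> the (Z t \<omega>))
            (at t within {t \<in> excursion_set space_time Z \<theta> (G \<times> {0..}) Gn \<omega>. 0 \<le> t \<and> ereal t < lifetime Z \<omega>})"
          by (rule tendsto_within_subset) simp
      qed
    qed
  qed
qed

end
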